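(* Let $(M,\prec)$ be an ordered simple matroid on $[n]$, with set of circuits $\mathfrak{C}(M)$, let $K$ be a field, and let $\mathcal{I}_\prec(M)\subset S=K[x_1,\ldots,x_n]$ be the Stanley-Reisner ideal of the broken circuit complex of $(M,\prec)$. The following conditions are equivalent: (i) $\mathcal{I}_\prec(M)$ is a complete intersection; (ii) the minimal broken circuits of $M$ (with respect to $\prec$) are pairwise disjoint; (iii) there exists a simple subset $\mathfrak{D}$ of $\mathfrak{C}(M)$ such that $$\mathfrak{C}(M)=\{\mathcal{C}(\mathfrak{D}'):\mathfrak{D}'\subseteq\mathfrak{D}\text{ is a tree}\}.$$
   Context: $[n]=\{1,\ldots,n\}$. A circuit of a matroid is a minimal dependent set; a matroid is simple if every circuit has at least 3 elements. An ordered matroid $(M,\prec)$ on $[n]$ is a matroid on $[n]$ with a linear ordering $\prec$ of $[n]$. For a circuit $C$, $\min_\prec(C)$ is its $\prec$-smallest element (also used to denote the set $\{\min_\prec(C)\}$), and $bc_\prec(C)=C-\min_\prec(C)$ is called a broken circuit; minimal broken circuits are those minimal with respect to inclusion. The broken circuit complex consists of all subsets of $[n]$ containing no broken circuit; its Stanley-Reisner ideal $\mathcal{I}_\prec(M)$ is generated by the monomials $\prod_{i\in bc_\prec(C)}x_i$, $C\in\mathfrak{C}(M)$. An ideal is a complete intersection if it is generated by a (possibly empty) regular sequence. For $\mathfrak{D}\subseteq\mathfrak{C}(M)$: $\mathfrak{D}$ is called simple (a simple subset) if for any distinct $C,C'\in\mathfrak{D}$ with $C\cap C'\neq\emptyset$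 one has $C\cap C'=\{\min_\prec(C)\}$ or $C\cap C'=\{\min_\prec(C')\}$ (equivalently, the broken circuits of the elements of $\mathfrak{D}$ are pairwise disjoint). The intersection graph $\mathcal{G}(\mathfrak{D})$ has vertex set $\mathfrak{D}$ and edges the pairs $\{C,C'\}$ of distinct elements with $C\cap C'\neq\emptyset$; $\mathfrak{D}$ is called a tree if $\mathcal{G}(\mathfrak{D})$ is a tree (in particular non-empty). Finally $$\mathcal{C}(\mathfrak{D})=\bigcup_{D\in\mathfrak{D}}D-\bigcup_{D,D'\in\mathfrak{D},\,D\neq D'}(D\cap D').$$ *)

theory Defs
  imports "HOL-Algebra.QuotRing" "HOL-Library.Poly_Mapping" "HOL-Library.Disjoint_Sets"
begin

section \<open>Matroids and circuits\<close>

locale matroid =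
  fixes E :: "'a set" and indep :: "'a set \<Rightarrow> bool"
  assumes finite_ground: "finite E"
    and indep_subset_ground: "indep X \<Longrightarrow> X \<subseteq> E"
    and indep_empty: "indep {}"
    and indep_subset: "indep Y \<Longrightarrow> X \<subseteq> Y \<Longrightarrow> indep X"
    and augmentation: "indep X \<Longrightarrow> indep Y \<Longrightarrow> card X < card Y \<Longrightarrow>
      \<exists>y\<in>Y - X. indep (insert y X)"

definition circuits :: "'a set \<Rightarrow> ('a set \<Rightarrow> bool) \<Rightarrow> 'a set set" where
  "circuits E indep = {C. C \<subseteq> E \<and> \<not> indep C \<and> (\<forall>X. X \<subset> C \<longrightarrow> indep X)}"

definition simple_matroid :: "'a set \<Rightarrow> ('a set \<Rightarrow> bool) \<Rightarrow> bool" where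
  "simple_matroid E indep \<longleftrightarrow> matroid E indep \<and> (\<forall>C\<in>circuits E indep. 3 \<le> card C)"

section \<open>Broken circuits\<close>

text \<open>Throughout, a linear ordering of the ground set is given by its reflexive relation \<open>r\<close>:
  \<open>(a, b) \<in> r\<close> means that \<open>a\<close> precedes or equals \<open>b\<close>.\<close>

definition min_elem :: "'a rel \<Rightarrow> 'a set \<Rightarrow> 'a" where
  "min_elem r C = (THE m. m \<in> C \<and> (\<forall>x\<in>C. (m, x) \<in> r))"

definition broken_circuit :: "'a rel \<Rightarrow> 'a set \<Rightarrow> 'a set" where
  "broken_circuit r C = C - {min_elem r C}"

definition broken_circuits :: "'a set \<Rightarrow> ('a set \<Rightarrow> bool) \<Rightarrow> 'a rel \<Rightarrow> 'a set set" where
  "broken_circuits E indep r = broken_circuit r ` circuits E indep"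

definition minimal_broken_circuits :: "'a set \<Rightarrow> ('a set \<Rightarrow> bool) \<Rightarrow> 'a rel \<Rightarrow> 'a set set" where
  "minimal_broken_circuits E indep r =
     {B \<in> broken_circuits E indep r. \<forall>B'\<in>broken_circuits E indep r. \<not> B' \<subset> B}"

definition broken_circuit_complex :: "'a set \<Rightarrow> ('a set \<Rightarrow> bool) \<Rightarrow> 'a rel \<Rightarrow> 'a set set" where
  "broken_circuit_complex E indep r =
     {F. F \<subseteq> E \<and> (\<forall>B\<in>broken_circuits E indep r. \<not> B \<subseteq> F)}"

section \<open>Polynomial rings and Stanley-Reisner ideals\<close>

text \<open>An element of \<open>('a \<Rightarrow>\<^sub>0 nat) \<Rightarrow>\<^sub>0 'k\<close> is a polynomial over \<open>'k\<close> with variables indexed by the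
  whole type \<open>'a\<close>: exponent vectors are mapped to coefficients.  The ring below consists of those
  polynomials in which only variables from \<open>V\<close> occur.\<close>

definition mpoly_ring :: "'a set \<Rightarrow> (('a \<Rightarrow>\<^sub>0 nat) \<Rightarrow>\<^sub>0 'k::field) ring" where
  "mpoly_ring V = \<lparr>carrier = {p. \<forall>m\<in>Poly_Mapping.keys p. Poly_Mapping.keys m \<subseteq> V},
     mult = (*), one = 1, zero = 0, add = (+)\<rparr>"

definition mvar :: "'a \<Rightarrow> ('a \<Rightarrow>\<^sub>0 nat) \<Rightarrow>\<^sub>0 'k::field" where
  "mvar i = Poly_Mapping.single (Poly_Mapping.single i 1) 1"

definition sqfree_monomial :: "'a set \<Rightarrow> ('a \<Rightarrow>\<^sub>0 nat) \<Rightarrow>\<^sub>0 'k::field" where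
  "sqfree_monomial F = (\<Prod>i\<in>F. mvar i)"

definition stanley_reisner_ideal :: "'a set \<Rightarrow> 'a set set \<Rightarrow> (('a \<Rightarrow>\<^sub>0 nat) \<Rightarrow>\<^sub>0 'k::field) set" where
  "stanley_reisner_ideal V \<Delta> = Idl\<^bsub>mpoly_ring V\<^esub> (sqfree_monomial ` {F. F \<subseteq> V \<and> F \<notin> \<Delta>})"

definition broken_circuit_ideal ::
    "'a set \<Rightarrow> ('a set \<Rightarrow> bool) \<Rightarrow> 'a rel \<Rightarrow> (('a \<Rightarrow>\<^sub>0 nat) \<Rightarrow>\<^sub>0 'k::field) set" where
  "broken_circuit_ideal E indep r = stanley_reisner_ideal E (broken_circuit_complex E indep r)"

section \<open>Regular sequences and complete intersections\<close>

definition non_zero_divisor :: "('a, 'b) ring_scheme \<Rightarrow> 'a \<Rightarrow> bool" where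
  "non_zero_divisor R a \<longleftrightarrow>
     a \<in> carrier R \<and> (\<forall>b\<in>carrier R. a \<otimes>\<^bsub>R\<^esub> b = \<zero>\<^bsub>R\<^esub> \<longrightarrow> b = \<zero>\<^bsub>R\<^esub>)"

text \<open>The last conjunct is the usual requirement that the quotient of \<open>R\<close> by the whole sequence be
  nonzero.\<close>

definition regular_sequence :: "('a, 'b) ring_scheme \<Rightarrow> 'a list \<Rightarrow> bool" where
  "regular_sequence R fs \<longleftrightarrow>
     set fs \<subseteq> carrier R \<and>
     (\<forall>i<length fs.
        let I = Idl\<^bsub>R\<^esub> (set (take i fs)) in non_zero_divisor (R Quot I) (I +>\<^bsub>R\<^esub> fs ! i)) \<and>
     Idl\<^bsub>R\<^esub> (set fs) \<noteq> carrier R"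

definition complete_intersection :: "('a, 'b) ring_scheme \<Rightarrow> 'a set \<Rightarrow> bool" where
  "complete_intersection R I \<longleftrightarrow> (\<exists>fs. regular_sequence R fs \<and> I = Idl\<^bsub>R\<^esub> (set fs))"

section \<open>Simple subsets and trees of circuits\<close>

definition simple_subset :: "'a rel \<Rightarrow> 'a set set \<Rightarrow> bool" where
  "simple_subset r \<D> \<longleftrightarrow>
     (\<forall>C\<in>\<D>. \<forall>C'\<in>\<D>. C \<noteq> C' \<and> C \<inter> C' \<noteq> {} \<longrightarrow>
        C \<inter> C' = {min_elem r C} \<or> C \<inter> C' = {min_elem r C'})"

text \<open>An undirected graph is a pair of a vertex set and a set of edges, which are two-element
  sets of vertices.\<close>

type_synonym 'v ugraph = "'v set \<times> 'v set set"

definition graph_connected :: "'v ugraph \<Rightarrow> bool" where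
  "graph_connected G \<longleftrightarrow> fst G \<noteq> {} \<and>
     (\<forall>u\<in>fst G. \<forall>v\<in>fst G. (u, v) \<in> {(x, y). {x, y} \<in> snd G}\<^sup>*)"

definition graph_cycle :: "'v ugraph \<Rightarrow> 'v list \<Rightarrow> bool" where
  "graph_cycle G c \<longleftrightarrow> 3 \<le> length c \<and> distinct c \<and> set c \<subseteq> fst G \<and>
     (\<forall>i. Suc i < length c \<longrightarrow> {c ! i, c ! Suc i} \<in> snd G) \<and> {last c, hd c} \<in> snd G"

definition is_tree :: "'v ugraph \<Rightarrow> bool" where
  "is_tree G \<longleftrightarrow> graph_connected G \<and> (\<nexists>c. graph_cycle G c)"

definition intersection_graph :: "'a set set \<Rightarrow> 'a set ugraph" where
  "intersection_graph \<D> =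
     (\<D>, {{C, C'} |C C'. C \<in> \<D> \<and> C' \<in> \<D> \<and> C \<noteq> C' \<and> C \<inter> C' \<noteq> {}})"

definition tree_circuit :: "'a set set \<Rightarrow> 'a set" where
  "tree_circuit \<D> = \<Union>\<D> - \<Union>{D \<inter> D' |D D'. D \<in> \<D> \<and> D' \<in> \<D> \<and> D \<noteq> D'}"

section \<open>Consistency of the definitions\<close>

lemma cring_mpoly_ring: "cring (mpoly_ring V :: (('a \<Rightarrow>\<^sub>0 nat) \<Rightarrow>\<^sub>0 'k::field) ring)"
proof -
  let ?R = "mpoly_ring V :: (('a \<Rightarrow>\<^sub>0 nat) \<Rightarrow>\<^sub>0 'k) ring"
  have add: "p + q \<in> carrier ?R" if pq: "p \<in> carrier ?R" "q \<in> carrier ?R" for p q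
    using pq keys_add[of p q] by (fastforce simp: mpoly_ring_def)
  have mult: "p * q \<in> carrier ?R" if pq: "p \<in> carrier ?R" "q \<in> carrier ?R" for p q
  proof -
    have "Poly_Mapping.keys m \<subseteq> V" if m: "m \<in> Poly_Mapping.keys (p * q)" for m
    proof -
      from m obtain a b
        where ab: "m = a + b" "a \<in> Poly_Mapping.keys p" "b \<in> Poly_Mapping.keys q"
        using keys_mult[of p q] by blast
      then have "Poly_Mapping.keys a \<subseteq> V" "Poly_Mapping.keys b \<subseteq> V"
        using pq by (simp_all add: mpoly_ring_def)
      then show ?thesis using keys_add[of a b] ab(1) by blast
    qed
    then show ?thesis by (simp add: mpoly_ring_def)
  qed
  have ops: "x \<oplus>\<^bsub>?R\<^esub> y = x + y" "x \<otimes>\<^bsub>?R\<^esub> y = x * y" "\<zero>\<^bsub>?R\<^esub> = 0" "\<one>\<^bsub>?R\<^esub> = 1" for x y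
    by (simp_all add: mpoly_ring_def)
  have zero_one: "0 \<in> carrier ?R" "1 \<in> carrier ?R"
    by (simp_all add: mpoly_ring_def)
  show ?thesis
  proof (rule cringI)
    show "abelian_group ?R"
    proof (rule abelian_groupI)
      fix x assume "x \<in> carrier ?R"
      then have "- x \<in> carrier ?R" by (simp add: mpoly_ring_def)
      then show "\<exists>y\<in>carrier ?R. y \<oplus>\<^bsub>?R\<^esub> x = \<zero>\<^bsub>?R\<^esub>"
        by (rule bexI[rotated]) (simp add: ops)
    qed (simp_all add: ops zero_one add ac_simps)
    show "comm_monoid ?R"
      by (rule comm_monoidI) (simp_all add: ops zero_one mult ac_simps)
  qed (simp add: ops distrib_right)
qed

lemma sqfree_monomial_carrier:
  assumes "F \<subseteq> V"
  shows "sqfree_monomial F \<in> carrier (mpoly_ring V :: (('a \<Rightarrow>\<^sub>0 nat) \<Rightarrow>\<^sub>0 'k::field) ring)"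
proof -
  interpret cring "mpoly_ring V :: (('a \<Rightarrow>\<^sub>0 nat) \<Rightarrow>\<^sub>0 'k::field) ring" by (rule cring_mpoly_ring)
  have "(\<Prod>i\<in>F. mvar i :: ('a \<Rightarrow>\<^sub>0 nat) \<Rightarrow>\<^sub>0 'k) \<in> carrier (mpoly_ring V)"
    using assms
  proof (induction F rule: infinite_finite_induct)
    case (insert x F)
    have "mvar x \<in> carrier (mpoly_ring V :: (('a \<Rightarrow>\<^sub>0 nat) \<Rightarrow>\<^sub>0 'k) ring)"
      using insert.prems by (simp add: mpoly_ring_def mvar_def)
    from m_closed[OF this insert.IH] insert show ?case by (simp add: mpoly_ring_def)
  qed (use one_closed in \<open>simp_all add: mpoly_ring_def\<close>)
  then show ?thesis by (simp add: sqfree_monomial_def)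
qed

text \<open>The monomials of the broken circuits generate the Stanley-Reisner ideal of the broken
  circuit complex.\<close>

lemma broken_circuit_ideal_generators:
  assumes "finite E"
  shows "(broken_circuit_ideal E indep r :: (('a \<Rightarrow>\<^sub>0 nat) \<Rightarrow>\<^sub>0 'k::field) set) =
    Idl\<^bsub>mpoly_ring E\<^esub> (sqfree_monomial ` broken_circuits E indep r)"
proof -
  let ?R = "mpoly_ring E :: (('a \<Rightarrow>\<^sub>0 nat) \<Rightarrow>\<^sub>0 'k) ring"
  let ?m = "sqfree_monomial :: 'a set \<Rightarrow> ('a \<Rightarrow>\<^sub>0 nat) \<Rightarrow>\<^sub>0 'k"
  let ?A = "{F. F \<subseteq> E \<and> F \<notin> broken_circuit_complex E indep r}"
  let ?B = "broken_circuits E indep r"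
  interpret cring ?R by (rule cring_mpoly_ring)
  have BE: "B \<subseteq> E" if "B \<in> ?B" for B
    using that by (auto simp: broken_circuits_def broken_circuit_def circuits_def)
  have Bc: "?m ` ?B \<subseteq> carrier ?R" and Ac: "?m ` ?A \<subseteq> carrier ?R"
    using BE sqfree_monomial_carrier by blast+
  have "Idl\<^bsub>?R\<^esub> (?m ` ?A) \<subseteq> Idl\<^bsub>?R\<^esub> (?m ` ?B)"
  proof (rule genideal_minimal[OF genideal_ideal[OF Bc]], safe)
    fix F assume F: "F \<subseteq> E" "F \<notin> broken_circuit_complex E indep r"
    then obtain B where B: "B \<in> ?B" "B \<subseteq> F" by (auto simp: broken_circuit_complex_def)
    have "finite F" using F(1) assms finite_subset by blast
    then have eq: "?m F = ?m (F - B) \<otimes>\<^bsub>?R\<^esub> ?m B"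
      using B(2) by (simp add: sqfree_monomial_def mpoly_ring_def prod.subset_diff)
    have "?m B \<in> Idl\<^bsub>?R\<^esub> (?m ` ?B)" using genideal_self[OF Bc] B(1) by blast
    moreover have "?m (F - B) \<in> carrier ?R" using F(1) by (intro sqfree_monomial_carrier) auto
    ultimately show "?m F \<in> Idl\<^bsub>?R\<^esub> (?m ` ?B)"
      unfolding eq by (rule ideal.I_l_closed[OF genideal_ideal[OF Bc]])
  qed
  moreover have "Idl\<^bsub>?R\<^esub> (?m ` ?B) \<subseteq> Idl\<^bsub>?R\<^esub> (?m ` ?A)"
  proof (rule genideal_minimal[OF genideal_ideal[OF Ac]])
    have "?B \<subseteq> ?A" using BE by (auto simp: broken_circuit_complex_def)
    then show "?m ` ?B \<subseteq> Idl\<^bsub>?R\<^esub> (?m ` ?A)"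
      by (rule order_trans[OF image_mono genideal_self[OF Ac]])
  qed
  ultimately show ?thesis
    unfolding broken_circuit_ideal_def stanley_reisner_ideal_def by (rule equalityI)
qed

end

theory Submission
  imports Defs
begin

text \<open>The first equivalence holds for every ideal \<open>I\<close> generated by a finite antichain of nonconstant
squarefree monomials. If the supports of the generators are pairwise disjoint, the generators
themselves form a regular sequence, since a polynomial cannot be pushed into a monomial ideal by
multiplying it with variables foreign to the generators.

For the converse, a regular sequence \<open>f\<^sub>i\<close> generating \<open>I\<close> has no relations \<open>\<Sum>i. a\<^sub>i f\<^sub>i = 0\<close> except
those with all \<open>a\<^sub>i \<in> I\<close> (\<open>regular_sequence_relations\<close>; in other words \<open>I/I\<^sup>2\<close> is free over \<open>S/I\<close>). Let
\<open>m\<^sub>1 = g u\<^sub>1\<close> and \<open>m\<^sub>2 = g u\<^sub>2\<close> be two minimal monomial generators with greatest common divisor \<open>g\<close>, and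
write both as combinations of the \<open>f\<^sub>i\<close> with coefficients \<open>a\<^sub>i\<close> and \<open>a'\<^sub>i\<close>. Minimality of \<open>m\<^sub>1\<close> forces
some \<open>a\<^sub>i\<close> to have a nonzero constant term. From \<open>u\<^sub>2 m\<^sub>1 = u\<^sub>1 m\<^sub>2\<close> one gets
\<open>u\<^sub>2 a\<^sub>i - u\<^sub>1 a'\<^sub>i \<in> I\<close>, and \<open>u\<^sub>2\<close> occurs in this element. As \<open>I\<close> is a monomial ideal, \<open>u\<^sub>2 \<in> I\<close>, and
minimality of \<open>m\<^sub>2\<close> gives \<open>g = 1\<close>.

The second equivalence rests on one observation: if \<open>D\<close> is a member of a simple family whose minimum
\<open>x\<close> is as large as possible, then every other member meets \<open>D\<close> at most in \<open>x\<close>. In a tree containing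
\<open>D\<close> and further members, all neighbours of \<open>D\<close> therefore contain \<open>x\<close>, so they are pairwise adjacent and, there being no
triangle, \<open>D\<close> is a leaf. Removing it leaves a tree \<open>T\<close> whose tree circuit contains \<open>x\<close>, and attaching
\<open>D\<close> again replaces \<open>x\<close> by the broken circuit \<open>D - {x}\<close> (\<open>tree_top_leaf\<close>, \<open>tree_circuit_attach\<close>). Both
inductions over families of circuits remove such a top member \<open>D\<close>.

For the step from trees to disjointness, \<open>tree_circuit_contains_broken_circuit\<close> shows that each
broken circuit contains one that comes from the simple family, so the minimal ones are among the
pairwise disjoint broken circuits of that family. For the step from disjointness to trees, one circuit
is chosen for each minimal broken circuit, and \<open>circuits_eq_tree_circuits\<close> identifies all circuits.
Its proof rests on two properties of circuits: they form an antichain and admit weak elimination. Both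
survive the deletion of an element \<open>b \<in> D - {x}\<close>, which removes exactly the member \<open>D\<close>
from the chosen family. Hence the circuits missing some element of \<open>D - {x}\<close> are known by induction,
and elimination with \<open>D\<close> relates the remaining ones to these.\<close>

section \<open>Ideals and regular sequences in the polynomial ring\<close>

lemma mpoly_ring_simps:
  "x \<oplus>\<^bsub>mpoly_ring V\<^esub> y = x + y" "x \<otimes>\<^bsub>mpoly_ring V\<^esub> y = x * y" "\<zero>\<^bsub>mpoly_ring V\<^esub> = 0" "\<one>\<^bsub>mpoly_ring V\<^esub> = 1"
  by (simp_all add: mpoly_ring_def)

lemma mem_carrier_mpoly_ring:
  "p \<in> carrier (mpoly_ring V) \<longleftrightarrow> (\<forall>m\<in>Poly_Mapping.keys p. Poly_Mapping.keys m \<subseteq> V)"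
  by (simp add: mpoly_ring_def)

lemma mpoly_ring_closed:
  fixes p q :: "('a \<Rightarrow>\<^sub>0 nat) \<Rightarrow>\<^sub>0 'k::field"
  assumes "p \<in> carrier (mpoly_ring V)" "q \<in> carrier (mpoly_ring V)"
  shows "p + q \<in> carrier (mpoly_ring V)" "p * q \<in> carrier (mpoly_ring V)"
    "- p \<in> carrier (mpoly_ring V)" "p - q \<in> carrier (mpoly_ring V)"
proof -
  interpret cring "mpoly_ring V :: (('a \<Rightarrow>\<^sub>0 nat) \<Rightarrow>\<^sub>0 'k) ring" by (rule cring_mpoly_ring)
  have add: "p + q \<in> carrier (mpoly_ring V)" if "q \<in> carrier (mpoly_ring V)" for q
    using a_closed[OF assms(1) that] by (simp add: mpoly_ring_simps)
  show "p + q \<in> carrier (mpoly_ring V)" by (rule add) fact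
  show "p * q \<in> carrier (mpoly_ring V)"
    using m_closed[OF assms] by (simp add: mpoly_ring_simps)
  show "- p \<in> carrier (mpoly_ring V)"
    using assms(1) by (simp add: mem_carrier_mpoly_ring)
  show "p - q \<in> carrier (mpoly_ring V)"
    using add[of "- q"] assms(2) by (simp add: mem_carrier_mpoly_ring)
qed

lemma mpoly_ring_const_closed [simp]:
  "0 \<in> carrier (mpoly_ring V)" "1 \<in> carrier (mpoly_ring V)"
  by (simp_all add: mpoly_ring_def)

lemma mpoly_ring_sum_closed:
  assumes "\<And>i. i \<in> I \<Longrightarrow> f i \<in> carrier (mpoly_ring V)"
  shows "sum f I \<in> carrier (mpoly_ring V)"
  using assms
  by (induction I rule: infinite_finite_induct) (auto intro: mpoly_ring_closed)

text \<open>The ring operations of \<^const>\<open>mpoly_ring\<close> are those of the type of polynomials. This criterion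
and its converse below translate between ideals of the ring and ordinary polynomial arithmetic.\<close>

lemma mpoly_ring_idealI:
  fixes I :: "(('a \<Rightarrow>\<^sub>0 nat) \<Rightarrow>\<^sub>0 'k::field) set"
  assumes sub: "I \<subseteq> carrier (mpoly_ring V)" and zero: "0 \<in> I"
    and add: "\<And>p q. p \<in> I \<Longrightarrow> q \<in> I \<Longrightarrow> p + q \<in> I"
    and mult: "\<And>a p. a \<in> carrier (mpoly_ring V) \<Longrightarrow> p \<in> I \<Longrightarrow> a * p \<in> I"
  shows "ideal I (mpoly_ring V)"
proof -
  interpret cring "mpoly_ring V :: (('a \<Rightarrow>\<^sub>0 nat) \<Rightarrow>\<^sub>0 'k) ring" by (rule cring_mpoly_ring)
  show ?thesis
  proof (rule idealI)
    show "subgroup I (add_monoid (mpoly_ring V))"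
    proof (rule add.subgroupI)
      fix p assume "p \<in> I"
      then have p: "p \<in> carrier (mpoly_ring V)" using sub by blast
      then have "\<ominus>\<^bsub>mpoly_ring V\<^esub> p = - p"
        by (intro minus_equality) (auto simp: mpoly_ring_simps mpoly_ring_closed)
      then show "\<ominus>\<^bsub>mpoly_ring V\<^esub> p \<in> I"
        using mult[of "-1" p] \<open>p \<in> I\<close> mpoly_ring_closed(3)[of 1 V 1]
        by simp
    qed (use assms in \<open>auto simp: mpoly_ring_simps\<close>)
  next
    fix p a :: "('a \<Rightarrow>\<^sub>0 nat) \<Rightarrow>\<^sub>0 'k"
    assume pa: "p \<in> I" "a \<in> carrier (mpoly_ring V)"
    show "a \<otimes>\<^bsub>mpoly_ring V\<^esub> p \<in> I" and "p \<otimes>\<^bsub>mpoly_ring V\<^esub> a \<in> I"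
      using mult[OF pa(2,1)] by (simp_all add: mpoly_ring_simps mult.commute)
  qed (rule ring_axioms)
qed

lemma ideal_mpoly_ringD:
  fixes I :: "(('a \<Rightarrow>\<^sub>0 nat) \<Rightarrow>\<^sub>0 'k::field) set"
  assumes "ideal I (mpoly_ring V)"
  shows "I \<subseteq> carrier (mpoly_ring V)" and "0 \<in> I"
    and "\<And>p q. p \<in> I \<Longrightarrow> q \<in> I \<Longrightarrow> p + q \<in> I"
    and "\<And>a p. a \<in> carrier (mpoly_ring V) \<Longrightarrow> p \<in> I \<Longrightarrow> a * p \<in> I"
    and "\<And>p q. p \<in> I \<Longrightarrow> q \<in> I \<Longrightarrow> p - q \<in> I"
    and "\<And>f A. (\<And>i. i \<in> A \<Longrightarrow> f i \<in> I) \<Longrightarrow> sum f A \<in> I"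
proof -
  interpret ideal I "mpoly_ring V" by fact
  show "I \<subseteq> carrier (mpoly_ring V)" by (rule a_subset)
  show z: "0 \<in> I"
    using additive_subgroup.zero_closed[OF is_additive_subgroup] by (simp add: mpoly_ring_simps)
  show add: "p + q \<in> I" if "p \<in> I" "q \<in> I" for p q
    using additive_subgroup.a_closed[OF is_additive_subgroup that] by (simp add: mpoly_ring_simps)
  show mult: "a * p \<in> I" if "a \<in> carrier (mpoly_ring V)" "p \<in> I" for a p
    using I_l_closed[OF that(2,1)] by (simp add: mpoly_ring_simps)
  show "p - q \<in> I" if "p \<in> I" "q \<in> I" for p q
    using add[OF that(1) mult[of "-1" q]] that(2) mpoly_ring_closed(3)[of 1 V 1] by simp
  show "sum f A \<in> I" if "\<And>i. i \<in> A \<Longrightarrow> f i \<in> I" for A and f :: "'b \<Rightarrow> _"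
    using that by (induction A rule: infinite_finite_induct) (auto simp: z add)
qed

lemma genideal_image_eq_combinations:
  fixes f :: "nat \<Rightarrow> ('a \<Rightarrow>\<^sub>0 nat) \<Rightarrow>\<^sub>0 'k::field"
  assumes "\<And>i. i < k \<Longrightarrow> f i \<in> carrier (mpoly_ring V)"
  shows "Idl\<^bsub>mpoly_ring V\<^esub> (f ` {..<k}) =
    {\<Sum>i<k. a i * f i |a. \<forall>i<k. a i \<in> carrier (mpoly_ring V)}" (is "?I = ?S")
proof
  interpret cring "mpoly_ring V :: (('a \<Rightarrow>\<^sub>0 nat) \<Rightarrow>\<^sub>0 'k) ring" by (rule cring_mpoly_ring)
  have carr: "f ` {..<k} \<subseteq> carrier (mpoly_ring V)" using assms by auto
  note I = ideal_mpoly_ringD[OF genideal_ideal[OF carr]]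
  show "?S \<subseteq> ?I"
    using genideal_self[OF carr] by (auto intro!: I(6) I(4))
  show "?I \<subseteq> ?S"
  proof (rule genideal_minimal)
    show "ideal ?S (mpoly_ring V)"
    proof (rule mpoly_ring_idealI)
      show "?S \<subseteq> carrier (mpoly_ring V)"
        using assms by (auto intro!: mpoly_ring_sum_closed mpoly_ring_closed)
      show "0 \<in> ?S" by (rule CollectI, rule exI[of _ "\<lambda>_. 0"]) simp
    next
      fix p q assume "p \<in> ?S" "q \<in> ?S"
      then obtain a b where "p = (\<Sum>i<k. a i * f i)" "q = (\<Sum>i<k. b i * f i)"
        "\<forall>i<k. a i \<in> carrier (mpoly_ring V)" "\<forall>i<k. b i \<in> carrier (mpoly_ring V)" by blast
      then show "p + q \<in> ?S"
        by (intro CollectI exI[of _ "\<lambda>i. a i + b i"])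
          (simp add: distrib_right sum.distrib mpoly_ring_closed)
    next
      fix c p :: "('a \<Rightarrow>\<^sub>0 nat) \<Rightarrow>\<^sub>0 'k"
      assume "c \<in> carrier (mpoly_ring V)" "p \<in> ?S"
      moreover from this obtain a where "p = (\<Sum>i<k. a i * f i)"
        "\<forall>i<k. a i \<in> carrier (mpoly_ring V)" by blast
      ultimately show "c * p \<in> ?S"
        by (intro CollectI exI[of _ "\<lambda>i. c * a i"])
          (simp add: sum_distrib_left mult.assoc mpoly_ring_closed)
    qed
    show "f ` {..<k} \<subseteq> ?S"
    proof
      fix p assume "p \<in> f ` {..<k}"
      then obtain j where "p = f j" "j < k" by blast
      then show "p \<in> ?S"
        by (intro CollectI exI[of _ "\<lambda>i. if i = j then 1 else 0"])
          (simp add: if_distrib[of "\<lambda>x. x * _"] sum.delta cong: if_cong)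
    qed
  qed
qed

lemma non_zero_divisor_Quot_iff:
  assumes "cring R" and "ideal I R" and f: "f \<in> carrier R"
  shows "non_zero_divisor (R Quot I) (I +>\<^bsub>R\<^esub> f) \<longleftrightarrow>
    (\<forall>b\<in>carrier R. f \<otimes>\<^bsub>R\<^esub> b \<in> I \<longrightarrow> b \<in> I)"
proof -
  interpret cring R by fact
  interpret I: ideal I R by fact
  have carr: "carrier (R Quot I) = (\<lambda>b. I +>\<^bsub>R\<^esub> b) ` carrier R"
    by (auto simp: FactRing_simps)
  have zero: "\<zero>\<^bsub>R Quot I\<^esub> = I" by (simp add: FactRing_def)
  have zero_iff: "I +>\<^bsub>R\<^esub> b = I \<longleftrightarrow> b \<in> I" if "b \<in> carrier R" for b
    using I.rcos_const_imp_mem[OF that] I.a_rcos_const by blast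
  have mult: "(I +>\<^bsub>R\<^esub> f) \<otimes>\<^bsub>R Quot I\<^esub> (I +>\<^bsub>R\<^esub> b) = I +>\<^bsub>R\<^esub> (f \<otimes>\<^bsub>R\<^esub> b)"
    if "b \<in> carrier R" for b
    using I.rcoset_mult_add[OF f that] by (simp add: FactRing_def)
  show ?thesis
    using f by (auto simp: non_zero_divisor_def carr zero zero_iff mult)
qed

lemma regular_sequence_mpoly_ring_iff:
  fixes fs :: "(('a \<Rightarrow>\<^sub>0 nat) \<Rightarrow>\<^sub>0 'k::field) list"
  shows "regular_sequence (mpoly_ring V) fs \<longleftrightarrow>
    (\<forall>i<length fs. fs ! i \<in> carrier (mpoly_ring V)) \<and>
    (\<forall>i<length fs. \<forall>b\<in>carrier (mpoly_ring V).
       fs ! i * b \<in> Idl\<^bsub>mpoly_ring V\<^esub> ((!) fs ` {..<i}) \<longrightarrow> b \<in> Idl\<^bsub>mpoly_ring V\<^esub> ((!) fs ` {..<i})) \<and>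
    Idl\<^bsub>mpoly_ring V\<^esub> (set fs) \<noteq> carrier (mpoly_ring V)"
proof -
  interpret cring "mpoly_ring V :: (('a \<Rightarrow>\<^sub>0 nat) \<Rightarrow>\<^sub>0 'k) ring" by (rule cring_mpoly_ring)
  have take: "set (take i fs) = (!) fs ` {..<i}" if "i < length fs" for i
    using that nth_image[of i fs] by (simp add: atLeast0LessThan)
  have "non_zero_divisor (mpoly_ring V Quot Idl\<^bsub>mpoly_ring V\<^esub> (set (take i fs)))
      (Idl\<^bsub>mpoly_ring V\<^esub> (set (take i fs)) +>\<^bsub>mpoly_ring V\<^esub> fs ! i) \<longleftrightarrow>
    (\<forall>b\<in>carrier (mpoly_ring V). fs ! i * b \<in> Idl\<^bsub>mpoly_ring V\<^esub> ((!) fs ` {..<i}) \<longrightarrow>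
       b \<in> Idl\<^bsub>mpoly_ring V\<^esub> ((!) fs ` {..<i}))"
    if "set fs \<subseteq> carrier (mpoly_ring V)" "i < length fs" for i
  proof -
    have "ideal (Idl\<^bsub>mpoly_ring V\<^esub> (set (take i fs))) (mpoly_ring V)"
      using that(1) set_take_subset[of i fs] by (intro genideal_ideal) blast
    moreover have "fs ! i \<in> carrier (mpoly_ring V)" using that by auto
    ultimately show ?thesis
      using that(2) by (simp add: non_zero_divisor_Quot_iff[OF cring_mpoly_ring] mpoly_ring_simps take)
  qed
  moreover have "set fs \<subseteq> carrier (mpoly_ring V) \<longleftrightarrow> (\<forall>i<length fs. fs ! i \<in> carrier (mpoly_ring V))"
    by (auto simp: set_conv_nth)
  ultimately show ?thesis
    unfolding regular_sequence_def Let_def by blast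
qed

text \<open>Regularity at the last index gives \<open>a\<^sub>k = \<Sum>i<k. c\<^sub>i f\<^sub>i\<close>, because \<open>a\<^sub>k f\<^sub>k\<close> is a combination of
the preceding \<open>f\<^sub>i\<close>. Substituting this turns the relation into the shorter one with coefficients
\<open>a\<^sub>i + c\<^sub>i f\<^sub>k\<close>, to which induction applies; these differ from the \<open>a\<^sub>i\<close> by elements of the ideal.\<close>

lemma regular_sequence_relations:
  fixes f :: "nat \<Rightarrow> ('a \<Rightarrow>\<^sub>0 nat) \<Rightarrow>\<^sub>0 'k::field"
  assumes "\<And>i. i < k \<Longrightarrow> f i \<in> carrier (mpoly_ring V)"
    and "\<And>i b. i < k \<Longrightarrow> b \<in> carrier (mpoly_ring V) \<Longrightarrow>
      f i * b \<in> Idl\<^bsub>mpoly_ring V\<^esub> (f ` {..<i}) \<Longrightarrow> b \<in> Idl\<^bsub>mpoly_ring V\<^esub> (f ` {..<i})"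
    and "\<And>i. i < k \<Longrightarrow> a i \<in> carrier (mpoly_ring V)"
    and "(\<Sum>i<k. a i * f i) = 0" and "i < k"
  shows "a i \<in> Idl\<^bsub>mpoly_ring V\<^esub> (f ` {..<k})"
  using assms
proof (induction k arbitrary: a i)
  case (Suc k)
  interpret cring "mpoly_ring V :: (('a \<Rightarrow>\<^sub>0 nat) \<Rightarrow>\<^sub>0 'k) ring" by (rule cring_mpoly_ring)
  let ?I = "\<lambda>k. Idl\<^bsub>mpoly_ring V\<^esub> (f ` {..<k})"
  have carr: "f ` {..<Suc k} \<subseteq> carrier (mpoly_ring V)" using Suc.prems(1) by auto
  note I' = ideal_mpoly_ringD[OF genideal_ideal[OF carr]]
  have comb: "?I k = {\<Sum>i<k. a i * f i |a. \<forall>i<k. a i \<in> carrier (mpoly_ring V)}"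
    using Suc.prems(1) by (intro genideal_image_eq_combinations) auto
  have mono: "?I k \<subseteq> ?I (Suc k)"
    using genideal_self[OF carr] by (intro genideal_minimal genideal_ideal carr) auto
  have "f k * a k = - (\<Sum>i<k. a i * f i)"
    using Suc.prems(4) by (simp add: mult.commute eq_neg_iff_add_eq_0 add.commute)
  also have "\<dots> = (\<Sum>i<k. - a i * f i)" by (simp add: sum_negf)
  also have "\<dots> \<in> ?I k" unfolding comb using Suc.prems(3)
    by (intro CollectI exI[of _ "\<lambda>i. - a i"]) (auto intro: mpoly_ring_closed)
  finally have ak: "a k \<in> ?I k" using Suc.prems(2)[of k "a k"] Suc.prems(3) by simp
  then obtain c where c: "a k = (\<Sum>i<k. c i * f i)" "\<And>i. i < k \<Longrightarrow> c i \<in> carrier (mpoly_ring V)"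
    unfolding comb by blast
  show ?case
  proof (cases "i = k")
    case False
    then have i: "i < k" using Suc.prems(5) by simp
    let ?a = "\<lambda>i. a i + c i * f k"
    have "(\<Sum>i<k. ?a i * f i) = (\<Sum>i<k. a i * f i) + a k * f k"
      unfolding c(1) by (simp add: sum_distrib_left sum.distrib distrib_left ac_simps)
    then have "(\<Sum>i<k. ?a i * f i) = 0" using Suc.prems(4) by simp
    then have "?a i \<in> ?I k"
    proof (intro Suc.IH[where a = ?a and i = i])
      show "f j \<in> carrier (mpoly_ring V)" if "j < k" for j
        using that Suc.prems(1) by simp
      show "b \<in> ?I j" if "j < k" "b \<in> carrier (mpoly_ring V)" "f j * b \<in> ?I j" for j b
        using Suc.prems(2)[of j b] that by simp
      show "?a j \<in> carrier (mpoly_ring V)" if "j < k" for j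
        using that Suc.prems(1,3) c(2) by (intro mpoly_ring_closed) auto
      show "i < k" by (rule i)
    qed
    then have "?a i - c i * f k \<in> ?I (Suc k)"
      using mono genideal_self[OF carr] c(2)[OF i] by (intro I'(5) I'(4)) auto
    then show ?thesis by simp
  qed (use ak mono in auto)
qed simp

section \<open>Squarefree monomial ideals\<close>

definition sqfree_exponent :: "'a set \<Rightarrow> 'a \<Rightarrow>\<^sub>0 nat" where
  "sqfree_exponent F = (\<Sum>i\<in>F. Poly_Mapping.single i 1)"

lemma lookup_sqfree_exponent:
  "finite F \<Longrightarrow> Poly_Mapping.lookup (sqfree_exponent F) i = (if i \<in> F then 1 else 0)"
  by (simp add: sqfree_exponent_def lookup_sum lookup_single when_def)

lemma keys_sqfree_exponent [simp]: "finite F \<Longrightarrow> Poly_Mapping.keys (sqfree_exponent F) = F"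
  by (auto simp: in_keys_iff lookup_sqfree_exponent split: if_splits)

lemma sqfree_monomial_eq_single:
  "finite F \<Longrightarrow> sqfree_monomial F = Poly_Mapping.single (sqfree_exponent F) (1 :: 'k::field)"
  by (induction F rule: finite_induct)
    (simp_all add: sqfree_monomial_def sqfree_exponent_def mvar_def mult_single)

lemma sqfree_monomial_disjoint_union:
  "finite F \<Longrightarrow> finite G \<Longrightarrow> F \<inter> G = {} \<Longrightarrow>
    sqfree_monomial F * sqfree_monomial G = (sqfree_monomial (F \<union> G) :: _ \<Rightarrow>\<^sub>0 'k::field)"
  by (simp add: sqfree_monomial_def prod.union_disjoint)

lemma keys_add_nat:
  "Poly_Mapping.keys (a + b :: 'a \<Rightarrow>\<^sub>0 nat) = Poly_Mapping.keys a \<union> Poly_Mapping.keys b"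
  by (auto simp: in_keys_iff lookup_add)

lemma lookup_single_mult_add:
  fixes p :: "('a \<Rightarrow>\<^sub>0 nat) \<Rightarrow>\<^sub>0 'k::field"
  shows "Poly_Mapping.lookup (Poly_Mapping.single s c * p) (s + t) = c * Poly_Mapping.lookup p t"
proof -
  have "Poly_Mapping.lookup (Poly_Mapping.single s c * p) (s + t) =
     (\<Sum>l. (c when s = l) * (\<Sum>q. Poly_Mapping.lookup p q when s + t = l + q))"
    by (simp add: lookup_mult lookup_single)
  also have "\<dots> = (\<Sum>l. (c * (\<Sum>q. Poly_Mapping.lookup p q when t = q)) when s = l)"
    by (rule arg_cong[of _ _ Sum_any]) (auto simp: when_def fun_eq_iff)
  finally show ?thesis by simp
qed

lemma poly_mapping_eq_sum_single:
  "(p :: 'b \<Rightarrow>\<^sub>0 'k::field) = (\<Sum>m\<in>Poly_Mapping.keys p. Poly_Mapping.single m (Poly_Mapping.lookup p m))"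
  by (rule poly_mapping_eqI) (simp add: lookup_sum lookup_single when_def sum.delta not_in_keys_iff_lookup_eq_zero)

text \<open>Squarefree divisibility of monomials is inclusion of supports, so membership in the ideal can be
read off from the supports of the exponents.\<close>

lemma mem_sqfree_ideal_iff:
  fixes p :: "('a \<Rightarrow>\<^sub>0 nat) \<Rightarrow>\<^sub>0 'k::field"
  assumes \<B>: "\<And>B. B \<in> \<B> \<Longrightarrow> B \<subseteq> V \<and> finite B"
  shows "p \<in> Idl\<^bsub>mpoly_ring V\<^esub> (sqfree_monomial ` \<B>) \<longleftrightarrow>
    p \<in> carrier (mpoly_ring V) \<and> (\<forall>m\<in>Poly_Mapping.keys p. \<exists>B\<in>\<B>. B \<subseteq> Poly_Mapping.keys m)"
proof -
  interpret cring "mpoly_ring V :: (('a \<Rightarrow>\<^sub>0 nat) \<Rightarrow>\<^sub>0 'k) ring" by (rule cring_mpoly_ring)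
  let ?I = "Idl\<^bsub>mpoly_ring V\<^esub> (sqfree_monomial ` \<B>) :: (('a \<Rightarrow>\<^sub>0 nat) \<Rightarrow>\<^sub>0 'k) set"
  define J where "J = {p \<in> carrier (mpoly_ring V) :: (('a \<Rightarrow>\<^sub>0 nat) \<Rightarrow>\<^sub>0 'k) set.
    \<forall>m\<in>Poly_Mapping.keys p. \<exists>B\<in>\<B>. B \<subseteq> Poly_Mapping.keys m}"
  have carr: "sqfree_monomial ` \<B> \<subseteq> carrier (mpoly_ring V :: (('a \<Rightarrow>\<^sub>0 nat) \<Rightarrow>\<^sub>0 'k) ring)"
    using \<B> sqfree_monomial_carrier by blast
  note I = ideal_mpoly_ringD[OF genideal_ideal[OF carr]]
  have "?I \<subseteq> J"
  proof (rule genideal_minimal)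
    show "ideal J (mpoly_ring V)"
    proof (rule mpoly_ring_idealI)
      fix p q assume "p \<in> J" "q \<in> J"
      then show "p + q \<in> J" using keys_add[of p q] by (auto simp: J_def mpoly_ring_closed)
    next
      fix a p :: "('a \<Rightarrow>\<^sub>0 nat) \<Rightarrow>\<^sub>0 'k"
      assume a: "a \<in> carrier (mpoly_ring V)" and p: "p \<in> J"
      have "\<exists>B\<in>\<B>. B \<subseteq> Poly_Mapping.keys m" if "m \<in> Poly_Mapping.keys (a * p)" for m
      proof -
        from that obtain s t where "m = s + t" "t \<in> Poly_Mapping.keys p"
          using keys_mult[of a p] by blast
        moreover from this p obtain B where "B \<in> \<B>" "B \<subseteq> Poly_Mapping.keys t"
          by (auto simp: J_def)
        ultimately show ?thesis by (auto simp: keys_add_nat)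
      qed
      then show "a * p \<in> J" using a p by (simp add: J_def mpoly_ring_closed)
    qed (auto simp: J_def)
    show "sqfree_monomial ` \<B> \<subseteq> J"
      using carr \<B> by (auto simp: J_def sqfree_monomial_eq_single)
  qed
  moreover have "J \<subseteq> ?I"
  proof
    fix p assume p: "p \<in> J"
    have "Poly_Mapping.single m (Poly_Mapping.lookup p m) \<in> ?I" if m: "m \<in> Poly_Mapping.keys p" for m
    proof -
      obtain B where B: "B \<in> \<B>" "B \<subseteq> Poly_Mapping.keys m" using p m by (auto simp: J_def)
      then have fin: "finite B" using \<B> by blast
      have eq: "m = (m - sqfree_exponent B) + sqfree_exponent B"
        using B(2) by (intro poly_mapping_eqI)
          (auto simp: lookup_add lookup_minus lookup_sqfree_exponent[OF fin] in_keys_iff)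
      have "Poly_Mapping.keys m \<subseteq> V" using p m by (auto simp: J_def mem_carrier_mpoly_ring)
      then have "Poly_Mapping.single (m - sqfree_exponent B) (Poly_Mapping.lookup p m) \<in> carrier (mpoly_ring V)"
        using keys_add_nat[of "m - sqfree_exponent B" "sqfree_exponent B"] eq
        by (auto simp: mem_carrier_mpoly_ring)
      then have "Poly_Mapping.single (m - sqfree_exponent B) (Poly_Mapping.lookup p m) * sqfree_monomial B \<in> ?I"
        using genideal_self[OF carr] B(1) by (intro I(4)) auto
      then show ?thesis using eq by (simp add: sqfree_monomial_eq_single[OF fin] mult_single)
    qed
    then show "p \<in> ?I" by (subst poly_mapping_eq_sum_single) (rule I(6))
  qed
  ultimately show ?thesis unfolding J_def by blast
qed

text \<open>Multiplying by the monomial of \<open>F\<close> shifts every exponent by variables which divide none of the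
generators, so a generator dividing the shifted monomial already divides the original one.\<close>

lemma sqfree_times_mem_idealD:
  fixes b :: "('a \<Rightarrow>\<^sub>0 nat) \<Rightarrow>\<^sub>0 'k::field"
  assumes \<B>: "\<And>B. B \<in> \<B> \<Longrightarrow> B \<subseteq> V \<and> finite B" and "finite F"
    and disj: "\<And>B. B \<in> \<B> \<Longrightarrow> B \<inter> F = {}"
    and b: "b \<in> carrier (mpoly_ring V)"
    and mem: "sqfree_monomial F * b \<in> Idl\<^bsub>mpoly_ring V\<^esub> (sqfree_monomial ` \<B>)"
  shows "b \<in> Idl\<^bsub>mpoly_ring V\<^esub> (sqfree_monomial ` \<B>)"
proof -
  have "\<exists>B\<in>\<B>. B \<subseteq> Poly_Mapping.keys m" if m: "m \<in> Poly_Mapping.keys b" for m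
  proof -
    have "sqfree_exponent F + m \<in> Poly_Mapping.keys (sqfree_monomial F * b)"
      using m by (simp add: sqfree_monomial_eq_single[OF \<open>finite F\<close>] in_keys_iff lookup_single_mult_add)
    then obtain B where "B \<in> \<B>" "B \<subseteq> Poly_Mapping.keys (sqfree_exponent F + m)"
      using mem mem_sqfree_ideal_iff[OF \<B>] by blast
    then have "B \<in> \<B>" "B \<subseteq> F \<union> Poly_Mapping.keys m"
      using \<open>finite F\<close> by (simp_all add: keys_add_nat)
    then show ?thesis using disj by blast
  qed
  then show ?thesis using b mem_sqfree_ideal_iff[OF \<B>] by blast
qed

text \<open>The generators, in any order, form the regular sequence: each one is a non-zero-divisor modulo its
predecessors because its variables occur in none of them. Since no generator is \<open>1\<close>, the ideal is
proper.\<close>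

lemma complete_intersection_if_disjoint:
  assumes \<B>: "\<And>B. B \<in> \<B> \<Longrightarrow> B \<subseteq> V \<and> finite B" and "finite \<B>" and "{} \<notin> \<B>" and "disjoint \<B>"
  shows "complete_intersection (mpoly_ring V :: (('a \<Rightarrow>\<^sub>0 nat) \<Rightarrow>\<^sub>0 'k::field) ring)
    (Idl\<^bsub>mpoly_ring V\<^esub> (sqfree_monomial ` \<B>))"
proof -
  let ?R = "mpoly_ring V :: (('a \<Rightarrow>\<^sub>0 nat) \<Rightarrow>\<^sub>0 'k) ring"
  obtain Bs where Bs: "set Bs = \<B>" "distinct Bs" using finite_distinct_list[OF \<open>finite \<B>\<close>] by blast
  let ?fs = "map sqfree_monomial Bs :: (('a \<Rightarrow>\<^sub>0 nat) \<Rightarrow>\<^sub>0 'k) list"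
  have nth: "Bs ! i \<in> \<B>" if "i < length Bs" for i using Bs(1) nth_mem that by blast
  have "regular_sequence ?R ?fs"
    unfolding regular_sequence_mpoly_ring_iff
  proof (intro conjI allI impI ballI)
    fix i assume "i < length ?fs"
    then show "?fs ! i \<in> carrier ?R" using nth \<B> by (simp add: sqfree_monomial_carrier)
  next
    fix i b assume i: "i < length ?fs" and b: "b \<in> carrier ?R"
      and mem: "?fs ! i * b \<in> Idl\<^bsub>?R\<^esub> ((!) ?fs ` {..<i})"
    have sub: "(!) Bs ` {..<i} \<subseteq> \<B>" using i nth by auto
    have gens: "(!) ?fs ` {..<i} = sqfree_monomial ` ((!) Bs ` {..<i})"
      using i by (force simp: image_image)
    show "b \<in> Idl\<^bsub>?R\<^esub> ((!) ?fs ` {..<i})"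
      unfolding gens
    proof (rule sqfree_times_mem_idealD[where F = "Bs ! i"])
      show "sqfree_monomial (Bs ! i) * b \<in> Idl\<^bsub>?R\<^esub> (sqfree_monomial ` (!) Bs ` {..<i})"
        using mem i unfolding gens by simp
    next
      fix B assume "B \<in> (!) Bs ` {..<i}"
      then obtain j where j: "j < i" "B = Bs ! j" by blast
      then have "Bs ! j \<noteq> Bs ! i" using i Bs(2) by (simp add: nth_eq_iff_index_eq)
      then show "B \<inter> Bs ! i = {}"
        using i j nth by (intro disjointD[OF \<open>disjoint \<B>\<close>]) simp_all
    next
      show "B \<subseteq> V \<and> finite B" if "B \<in> (!) Bs ` {..<i}" for B using that sub \<B> by blast
    qed (use i b nth \<B> in auto)
  next
    have "1 \<notin> Idl\<^bsub>?R\<^esub> (sqfree_monomial ` \<B>)"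
      using \<open>{} \<notin> \<B>\<close> by (auto simp: mem_sqfree_ideal_iff[OF \<B>])
    moreover have "1 \<in> carrier ?R" by simp
    ultimately show "Idl\<^bsub>?R\<^esub> (set ?fs) \<noteq> carrier ?R"
      unfolding set_map Bs(1) by blast
  qed
  then show ?thesis
    unfolding complete_intersection_def by (intro exI[of _ ?fs]) (simp add: Bs(1))
qed

text \<open>Free conormal module against the syzygy \<open>u\<^sub>2 m\<^sub>1 = u\<^sub>1 m\<^sub>2\<close> of two generators: a coefficient of
this syzygy with respect to the regular sequence lies in the ideal, although the monomial \<open>u\<^sub>2\<close> occurs
in it.\<close>

lemma disjoint_if_complete_intersection:
  assumes \<B>: "\<And>B. B \<in> \<B> \<Longrightarrow> B \<subseteq> V \<and> finite B"
    and antichain: "\<And>B B'. B \<in> \<B> \<Longrightarrow> B' \<in> \<B> \<Longrightarrow> \<not> B' \<subset> B"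
    and ci: "complete_intersection (mpoly_ring V :: (('a \<Rightarrow>\<^sub>0 nat) \<Rightarrow>\<^sub>0 'k::field) ring)
      (Idl\<^bsub>mpoly_ring V\<^esub> (sqfree_monomial ` \<B>))"
  shows "disjoint \<B>"
proof (rule disjointI)
  fix B1 B2 assume B1: "B1 \<in> \<B>" and B2: "B2 \<in> \<B>" and "B1 \<noteq> B2"
  let ?R = "mpoly_ring V :: (('a \<Rightarrow>\<^sub>0 nat) \<Rightarrow>\<^sub>0 'k) ring"
  let ?m = "sqfree_monomial :: 'a set \<Rightarrow> ('a \<Rightarrow>\<^sub>0 nat) \<Rightarrow>\<^sub>0 'k"
  let ?I = "Idl\<^bsub>?R\<^esub> (?m ` \<B>)"
  interpret cring ?R by (rule cring_mpoly_ring)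
  have fin: "finite B1" "finite B2" using \<B> B1 B2 by auto
  obtain fs where reg: "regular_sequence ?R fs" and I_fs: "?I = Idl\<^bsub>?R\<^esub> (set fs)"
    using ci unfolding complete_intersection_def by blast
  let ?f = "(!) fs" and ?k = "length fs"
  have set_fs: "set fs = ?f ` {..<?k}" by (auto simp: set_conv_nth)
  have f_carr: "?f i \<in> carrier ?R" if "i < ?k" for i
    using reg that by (simp add: regular_sequence_mpoly_ring_iff)
  have I_comb: "?I = {\<Sum>i<?k. a i * ?f i |a. \<forall>i<?k. a i \<in> carrier ?R}"
    unfolding I_fs set_fs using f_carr by (rule genideal_image_eq_combinations)
  have f_mem: "?f i \<in> ?I" if "i < ?k" for i
    using genideal_self[of "set fs"] f_carr that unfolding I_fs by (auto simp: set_fs)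
  have m_mem: "?m B \<in> ?I" if "B \<in> \<B>" for B
    using genideal_self[of "?m ` \<B>"] \<B> that sqfree_monomial_carrier by blast
  obtain a where a: "?m B1 = (\<Sum>i<?k. a i * ?f i)" "\<And>i. i < ?k \<Longrightarrow> a i \<in> carrier ?R"
    using m_mem[OF B1] unfolding I_comb by blast
  obtain a' where a': "?m B2 = (\<Sum>i<?k. a' i * ?f i)" "\<And>i. i < ?k \<Longrightarrow> a' i \<in> carrier ?R"
    using m_mem[OF B2] unfolding I_comb by blast

  \<comment> \<open>Otherwise each monomial of \<open>\<Sum>i. a\<^sub>i f\<^sub>i\<close> is a proper multiple of some generator, but the monomial
    of \<open>B1\<close> is not.\<close>
  have "\<exists>i<?k. Poly_Mapping.lookup (a i) 0 \<noteq> 0"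
  proof -
    have "Poly_Mapping.lookup (?m B1) (sqfree_exponent B1) \<noteq> 0"
      by (simp add: sqfree_monomial_eq_single[OF fin(1)])
    then have "(\<Sum>i<?k. Poly_Mapping.lookup (a i * ?f i) (sqfree_exponent B1)) \<noteq> 0"
      by (simp add: a(1) lookup_sum)
    then obtain i where i: "i < ?k" "Poly_Mapping.lookup (a i * ?f i) (sqfree_exponent B1) \<noteq> 0"
      by (meson lessThan_iff sum.neutral)
    then obtain s t where st: "sqfree_exponent B1 = s + t" "s \<in> Poly_Mapping.keys (a i)" "t \<in> Poly_Mapping.keys (?f i)"
      using keys_mult[of "a i" "?f i"] by (auto simp: in_keys_iff)
    obtain B where B: "B \<in> \<B>" "B \<subseteq> Poly_Mapping.keys t"
      using f_mem[OF i(1)] st(3) mem_sqfree_ideal_iff[OF \<B>] by blast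
    have un: "B1 = Poly_Mapping.keys s \<union> Poly_Mapping.keys t"
      using arg_cong[OF st(1), of Poly_Mapping.keys] fin by (simp add: keys_add_nat)
    then have sub: "B1 \<subseteq> Poly_Mapping.keys t" using B antichain[OF B1 B(1)] by blast
    have "s = 0"
    proof (rule poly_mapping_eqI)
      fix j
      have "Poly_Mapping.lookup s j + Poly_Mapping.lookup t j = (if j \<in> B1 then 1 else 0)"
        using arg_cong[OF st(1), of "\<lambda>m. Poly_Mapping.lookup m j"] fin by (simp add: lookup_sqfree_exponent lookup_add)
      moreover have "Poly_Mapping.lookup t j \<noteq> 0" if "j \<in> B1" using sub that by (auto simp: in_keys_iff)
      ultimately show "Poly_Mapping.lookup s j = Poly_Mapping.lookup 0 j"
        by (cases "j \<in> B1") auto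
    qed
    then show ?thesis using i(1) st(2) by (auto simp: in_keys_iff)
  qed
  then obtain i where i: "i < ?k" "Poly_Mapping.lookup (a i) 0 \<noteq> 0" by blast

  let ?u1 = "?m (B1 - B2)" and ?u2 = "?m (B2 - B1)"
  let ?c = "\<lambda>i. ?u2 * a i - ?u1 * a' i"
  have "?u2 * ?m B1 = ?u1 * ?m B2"
    using fin sqfree_monomial_disjoint_union[of "B2 - B1" B1, where 'k = 'k]
      sqfree_monomial_disjoint_union[of "B1 - B2" B2, where 'k = 'k]
    by (simp add: Un_commute Int_commute)
  then have rel: "(\<Sum>i<?k. ?c i * ?f i) = 0"
    by (simp add: a(1) a'(1) sum_distrib_left left_diff_distrib sum_subtractf mult.assoc)
  have "?u1 \<in> carrier ?R" "?u2 \<in> carrier ?R"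
    using \<B> B1 B2 by (auto intro!: sqfree_monomial_carrier)
  then have "?c i \<in> carrier ?R" if "i < ?k" for i
    using a(2) a'(2) that by (simp add: mpoly_ring_closed)
  then have c_mem: "?c i \<in> ?I"
    unfolding I_fs set_fs using reg rel i(1)
    by (intro regular_sequence_relations[where a = ?c and f = ?f])
      (auto simp: regular_sequence_mpoly_ring_iff)

  let ?e = "sqfree_exponent (B2 - B1)"
  have "Poly_Mapping.lookup (?u2 * a i) ?e = Poly_Mapping.lookup (a i) 0"
    using lookup_single_mult_add[of ?e 1 "a i" 0] fin by (simp add: sqfree_monomial_eq_single)
  \<comment> \<open>Every monomial of this product is divisible by the nonconstant monomial \<open>u\<^sub>1\<close>, which is coprime
    to \<open>u\<^sub>2\<close>.\<close>
  moreover have "Poly_Mapping.lookup (?u1 * a' i) ?e = 0"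
  proof (rule ccontr)
    assume "Poly_Mapping.lookup (?u1 * a' i) ?e \<noteq> 0"
    then obtain s where "?e = sqfree_exponent (B1 - B2) + s"
      using keys_mult[of ?u1 "a' i"] fin
      by (auto simp: in_keys_iff[symmetric] sqfree_monomial_eq_single split: if_splits)
    then have "Poly_Mapping.keys ?e = Poly_Mapping.keys (sqfree_exponent (B1 - B2) + s)" by simp
    then have "B1 - B2 \<subseteq> B2 - B1" using fin by (auto simp: keys_add_nat)
    then show False using antichain[OF B2 B1] \<open>B1 \<noteq> B2\<close> by blast
  qed
  ultimately have "?e \<in> Poly_Mapping.keys (?c i)"
    using i(2) by (simp add: in_keys_iff lookup_minus)
  then obtain B where "B \<in> \<B>" "B \<subseteq> B2 - B1"
    using c_mem fin mem_sqfree_ideal_iff[OF \<B>] by (metis finite_Diff keys_sqfree_exponent)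
  then show "B1 \<inter> B2 = {}" using antichain[OF B2, of B] by blast
qed


section \<open>Minima in a linear order\<close>

lemma finite_linear_order_has_min:
  assumes "linear_order_on E r" and "finite X" and "X \<noteq> {}" and "X \<subseteq> E"
  shows "\<exists>m\<in>X. \<forall>x\<in>X. (m, x) \<in> r"
  using assms(2-4)
proof (induction X rule: finite_ne_induct)
  case (singleton x)
  then show ?case using assms(1) by (auto simp: order_on_defs refl_on_def)
next
  case (insert x F)
  then obtain m where m: "m \<in> F" "\<forall>y\<in>F. (m, y) \<in> r" by auto
  have "trans r" and "(x, x) \<in> r"
    using assms(1) insert.prems by (auto simp: order_on_defs refl_on_def)
  show ?case
  proof (cases "(m, x) \<in> r")
    case False
    then have "(x, m) \<in> r"
      using assms(1) m(1) insert by (auto simp: order_on_defs total_on_def)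
    then show ?thesis using m \<open>trans r\<close> \<open>(x, x) \<in> r\<close> by (auto dest: transD)
  qed (use m in auto)
qed

lemma finite_linear_order_has_max:
  assumes "linear_order_on E r" and "finite X" and "X \<noteq> {}" and "X \<subseteq> E"
  shows "\<exists>m\<in>X. \<forall>x\<in>X. (x, m) \<in> r"
  using finite_linear_order_has_min[of E "r\<inverse>" X] assms by simp

lemma min_elem:
  assumes "linear_order_on E r" and "finite C" and "C \<noteq> {}" and "C \<subseteq> E"
  shows min_elem_mem: "min_elem r C \<in> C" and min_elem_le: "\<And>x. x \<in> C \<Longrightarrow> (min_elem r C, x) \<in> r"
proof -
  obtain m where m: "m \<in> C" "\<forall>x\<in>C. (m, x) \<in> r"
    using finite_linear_order_has_min[OF assms] by blast
  moreover have "antisym r" using assms(1) by (simp add: order_on_defs)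
  ultimately have "min_elem r C = m"
    unfolding min_elem_def by (intro the_equality) (auto dest: antisymD)
  then show "min_elem r C \<in> C" "\<And>x. x \<in> C \<Longrightarrow> (min_elem r C, x) \<in> r" using m by auto
qed

section \<open>Leaves of intersection graphs\<close>

lemma intersection_graph_simps [simp]:
  "fst (intersection_graph T) = T"
  "{X, Y} \<in> snd (intersection_graph T) \<longleftrightarrow> X \<in> T \<and> Y \<in> T \<and> X \<noteq> Y \<and> X \<inter> Y \<noteq> {}"
  by (auto simp: intersection_graph_def doubleton_eq_iff)

text \<open>The predecessor and the successor of a vertex along the cycle differ because the cycle has at least
three vertices; the indices wrap around at the two ends of the list.\<close>

lemma graph_cycle_two_neighbours:
  assumes "graph_cycle G c" and "v \<in> set c"
  obtains u w where "u \<in> set c" "w \<in> set c" "u \<noteq> w" "{v, u} \<in> snd G" "{v, w} \<in> snd G"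
proof -
  have c: "3 \<le> length c" "distinct c" "{last c, hd c} \<in> snd G"
    and step: "\<And>i. Suc i < length c \<Longrightarrow> {c ! i, c ! Suc i} \<in> snd G"
    using assms(1) by (auto simp: graph_cycle_def)
  have "c \<noteq> []" using c(1) by auto
  then have wrap: "{c ! (length c - 1), c ! 0} \<in> snd G"
    using c(3) by (simp add: last_conv_nth hd_conv_nth)
  obtain i where i: "i < length c" "v = c ! i" using assms(2) by (auto simp: in_set_conv_nth)
  define p where "p = (if i = 0 then length c - 1 else i - 1)"
  define s where "s = (if Suc i = length c then 0 else Suc i)"
  have "p < length c" "s < length c" "p \<noteq> s" using i(1) c(1) by (auto simp: p_def s_def)
  then have "c ! p \<noteq> c ! s" using c(2) by (simp add: nth_eq_iff_index_eq)
  moreover have "{v, c ! p} \<in> snd G"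
    using step[of "i - 1"] wrap i by (auto simp: p_def insert_commute)
  moreover have "{v, c ! s} \<in> snd G"
  proof (cases "Suc i = length c")
    case True
    then have "i = length c - 1" by simp
    then show ?thesis using wrap i(2) True by (simp add: s_def)
  qed (use step[of i] i in \<open>auto simp: s_def\<close>)
  ultimately show ?thesis
    using that[of "c ! p" "c ! s"] \<open>p < length c\<close> \<open>s < length c\<close> by simp
qed

lemma is_tree_singleton: "is_tree (intersection_graph {D})"
proof -
  have "\<not> graph_cycle (intersection_graph {D}) c" for c
    using card_mono[of "{D}" "set c"] by (auto simp: graph_cycle_def distinct_card)
  then show ?thesis by (auto simp: is_tree_def graph_connected_def)
qed

lemma is_tree_neighbour:
  assumes "is_tree (intersection_graph T)" and "D \<in> T" and "T \<noteq> {D}"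
  obtains D' where "D' \<in> T" "D' \<noteq> D" "D \<inter> D' \<noteq> {}"
proof -
  obtain X where X: "X \<in> T" "X \<noteq> D" using assms(2,3) by blast
  then have "(D, X) \<in> {(x, y). {x, y} \<in> snd (intersection_graph T)}\<^sup>*"
    using assms(1,2) unfolding is_tree_def graph_connected_def by simp
  then show ?thesis
    by (cases rule: converse_rtranclE) (use X that in auto)
qed

text \<open>Three members through a common point are pairwise adjacent, hence form a triangle in the
intersection graph.\<close>

lemma is_tree_no_triple_intersection:
  assumes "is_tree (intersection_graph T)" and "X \<in> T" "Y \<in> T" "Z \<in> T"
    and "x \<in> X" "x \<in> Y" "x \<in> Z" and "X \<noteq> Y" "X \<noteq> Z"
  shows "Y = Z"
proof (rule ccontr)
  assume "Y \<noteq> Z"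
  then have "graph_cycle (intersection_graph T) [X, Y, Z]"
    using assms by (auto simp: graph_cycle_def less_Suc_eq nth_Cons')
  then show False using assms(1) by (auto simp: is_tree_def)
qed

text \<open>A cycle through the new vertex would need two distinct neighbours of it.\<close>

lemma is_tree_insert_leaf:
  assumes tree: "is_tree (intersection_graph T)" and "D \<notin> T" and D': "D' \<in> T" "D \<inter> D' \<noteq> {}"
    and leaf: "\<And>X. X \<in> T \<Longrightarrow> X \<noteq> D' \<Longrightarrow> D \<inter> X = {}"
  shows "is_tree (intersection_graph (insert D T))"
proof -
  let ?G = "intersection_graph T" and ?H = "intersection_graph (insert D T)"
  let ?r = "\<lambda>G. {(x, y). {x, y} \<in> snd G}"
  have "(u, v) \<in> (?r ?H)\<^sup>*" if uv: "u \<in> insert D T" "v \<in> insert D T" for u v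
  proof -
    have "(?r ?G)\<^sup>* \<subseteq> (?r ?H)\<^sup>*" by (rule rtrancl_mono) auto
    then have in_T: "(u, v) \<in> (?r ?H)\<^sup>*" if "u \<in> T" "v \<in> T" for u v
      using tree that unfolding is_tree_def graph_connected_def by auto
    have to_D': "(u, D') \<in> (?r ?H)\<^sup>*" "(D', u) \<in> (?r ?H)\<^sup>*" if "u \<in> insert D T" for u
    proof -
      have "(D, D') \<in> ?r ?H" "(D', D) \<in> ?r ?H" using D' \<open>D \<notin> T\<close> by (auto simp: insert_commute)
      then show "(u, D') \<in> (?r ?H)\<^sup>*" "(D', u) \<in> (?r ?H)\<^sup>*"
        using that in_T[OF _ D'(1)] in_T[OF D'(1)] by (cases "u = D"; blast)+
    qed
    show ?thesis using to_D'(1)[OF uv(1)] to_D'(2)[OF uv(2)] by (rule rtrancl_trans)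
  qed
  then have "graph_connected ?H" by (simp add: graph_connected_def)
  moreover have "\<not> graph_cycle ?H c" for c
  proof
    assume c: "graph_cycle ?H c"
    have "D \<notin> set c"
    proof
      assume "D \<in> set c"
      then obtain u w where "u \<noteq> w" "{D, u} \<in> snd ?H" "{D, w} \<in> snd ?H"
        using graph_cycle_two_neighbours[OF c] by metis
      then show False using leaf[of u] leaf[of w] by auto
    qed
    then have "set c \<subseteq> T" and "c \<noteq> []" using c by (auto simp: graph_cycle_def)
    then have "c ! i \<in> T" if "i < length c" for i using that nth_mem by blast
    moreover have "last c \<in> T" "hd c \<in> T" using \<open>set c \<subseteq> T\<close> \<open>c \<noteq> []\<close> by auto
    ultimately have "graph_cycle ?G c"
      using c \<open>set c \<subseteq> T\<close> unfolding graph_cycle_def by simp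
    then show False using tree by (auto simp: is_tree_def)
  qed
  ultimately show ?thesis by (simp add: is_tree_def)
qed

text \<open>Connectedness survives because moving the leaf onto its neighbour maps every walk of the old graph
to a walk of the new one.\<close>

lemma is_tree_remove_leaf:
  assumes tree: "is_tree (intersection_graph T)" and D': "D' \<in> T" "D' \<noteq> D"
    and leaf: "\<And>X. X \<in> T \<Longrightarrow> X \<noteq> D \<Longrightarrow> X \<noteq> D' \<Longrightarrow> D \<inter> X = {}"
  shows "is_tree (intersection_graph (T - {D}))"
proof -
  let ?G = "intersection_graph T" and ?H = "intersection_graph (T - {D})"
  let ?r = "\<lambda>G. {(x, y). {x, y} \<in> snd G}"
  define f where "f X = (if X = D then D' else X)" for X
  have step: "(f X, f Y) \<in> (?r ?H)\<^sup>*" if "(X, Y) \<in> ?r ?G" for X Y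
  proof -
    from that have XY: "X \<in> T" "Y \<in> T" "X \<noteq> Y" "X \<inter> Y \<noteq> {}" by auto
    consider "X = D" | "Y = D" | "X \<noteq> D" "Y \<noteq> D" by blast
    then show ?thesis
    proof cases
      case 1
      then have "Y = D'" using leaf[of Y] XY by blast
      then show ?thesis using 1 D' by (simp add: f_def)
    next
      case 2
      then have "X = D'" using leaf[of X] XY by blast
      then show ?thesis using 2 D' by (simp add: f_def)
    next
      case 3
      then show ?thesis using XY by (simp add: f_def r_into_rtrancl)
    qed
  qed
  have f_path: "(f X, f Y) \<in> (?r ?H)\<^sup>*" if "(X, Y) \<in> (?r ?G)\<^sup>*" for X Y
    using that by (induction rule: rtrancl_induct) (use step in \<open>auto intro: rtrancl_trans\<close>)
  have "(u, v) \<in> (?r ?H)\<^sup>*" if uv: "u \<in> T - {D}" "v \<in> T - {D}" for u v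
  proof -
    have "(u, v) \<in> (?r ?G)\<^sup>*" using tree uv unfolding is_tree_def graph_connected_def by simp
    then show ?thesis using f_path[of u v] uv by (simp add: f_def)
  qed
  then have "graph_connected ?H" using D' by (auto simp: graph_connected_def)
  moreover have "\<not> graph_cycle ?H c" for c
  proof
    assume "graph_cycle ?H c"
    then have "graph_cycle ?G c" by (auto simp: graph_cycle_def)
    then show False using tree by (auto simp: is_tree_def)
  qed
  ultimately show ?thesis by (simp add: is_tree_def)
qed

section \<open>Attaching a member to a tree\<close>

lemma mem_tree_circuit_iff: "y \<in> tree_circuit T \<longleftrightarrow> (\<exists>!D. D \<in> T \<and> y \<in> D)"
  unfolding tree_circuit_def by blast

lemma tree_circuit_singleton [simp]: "tree_circuit {D} = D"
  by (auto simp: mem_tree_circuit_iff)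

lemma tree_circuit_subset: "tree_circuit T \<subseteq> \<Union>T"
  by (auto simp: tree_circuit_def)

lemma is_tree_attach:
  assumes tree: "is_tree (intersection_graph T)" and "D \<notin> T" and D: "D \<inter> \<Union>T = {x}"
    and x: "x \<in> tree_circuit T"
  shows "is_tree (intersection_graph (insert D T))"
proof -
  obtain D' where D': "D' \<in> T" "x \<in> D'" "\<And>X. X \<in> T \<Longrightarrow> x \<in> X \<Longrightarrow> X = D'"
    using x unfolding mem_tree_circuit_iff by blast
  show ?thesis
  proof (rule is_tree_insert_leaf[OF tree \<open>D \<notin> T\<close> D'(1)])
    show "D \<inter> D' \<noteq> {}" using D D' by blast
    show "D \<inter> X = {}" if "X \<in> T" "X \<noteq> D'" for X
    proof -
      have "x \<notin> X" using D'(3)[OF that(1)] that(2) by blast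
      then show ?thesis using D that(1) by auto
    qed
  qed
qed

text \<open>On trees this is the combinatorial shadow of eliminating \<open>x\<close> between the tree circuit of \<open>T\<close> and
the circuit \<open>D\<close>.\<close>

lemma tree_circuit_attach:
  assumes "D \<notin> T" and D: "D \<inter> \<Union>T = {x}"
  shows "tree_circuit (insert D T) = (tree_circuit T - {x}) \<union> (D - {x})"
proof (rule Set.set_eqI)
  fix y
  show "y \<in> tree_circuit (insert D T) \<longleftrightarrow> y \<in> (tree_circuit T - {x}) \<union> (D - {x})"
  proof (cases "y \<in> D")
    case True
    then have "y = x \<or> y \<notin> \<Union>T" and "x \<in> \<Union>T" using D by auto
    then show ?thesis using True \<open>D \<notin> T\<close> unfolding mem_tree_circuit_iff by (auto; metis)
  next
    case False
    then have "y \<noteq> x" using D by blast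
    moreover have "y \<in> tree_circuit (insert D T) \<longleftrightarrow> y \<in> tree_circuit T"
      using False unfolding mem_tree_circuit_iff by blast
    ultimately show ?thesis using False by blast
  qed
qed

section \<open>Simple subsets\<close>

lemma simple_subset_mono: "simple_subset r \<D> \<Longrightarrow> \<D>' \<subseteq> \<D> \<Longrightarrow> simple_subset r \<D>'"
  unfolding simple_subset_def by blast

text \<open>If the broken circuits of \<open>D\<close> and \<open>D'\<close> are disjoint, every common point is one of the two minima;
if both minima were common points, each would precede the other.\<close>

lemma simple_subset_iff_disjoint_broken_circuits:
  assumes r: "linear_order_on E r"
    and \<D>: "\<And>D. D \<in> \<D> \<Longrightarrow> finite D \<and> D \<noteq> {} \<and> D \<subseteq> E"
  shows "simple_subset r \<D> \<longleftrightarrow>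
    (\<forall>D\<in>\<D>. \<forall>D'\<in>\<D>. D \<noteq> D' \<longrightarrow> broken_circuit r D \<inter> broken_circuit r D' = {})"
proof
  assume "simple_subset r \<D>"
  then show "\<forall>D\<in>\<D>. \<forall>D'\<in>\<D>. D \<noteq> D' \<longrightarrow> broken_circuit r D \<inter> broken_circuit r D' = {}"
    unfolding simple_subset_def broken_circuit_def by blast
next
  assume disj: "\<forall>D\<in>\<D>. \<forall>D'\<in>\<D>. D \<noteq> D' \<longrightarrow> broken_circuit r D \<inter> broken_circuit r D' = {}"
  have antisym: "antisym r" using r by (simp add: order_on_defs)
  show "simple_subset r \<D>"
    unfolding simple_subset_def
  proof (intro ballI impI)
    fix D D' assume D: "D \<in> \<D>" "D' \<in> \<D>" and ne: "D \<noteq> D' \<and> D \<inter> D' \<noteq> {}"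
    let ?m = "min_elem r D" and ?m' = "min_elem r D'"
    have sub: "D \<inter> D' \<subseteq> {?m, ?m'}"
      using disj D ne unfolding broken_circuit_def by blast
    have "?m = ?m'" if "?m \<in> D'" "?m' \<in> D"
      using min_elem_le[OF r, of D ?m'] min_elem_le[OF r, of D' ?m] \<D>[OF D(1)] \<D>[OF D(2)] that
        antisymD[OF antisym] by blast
    then show "D \<inter> D' = {?m} \<or> D \<inter> D' = {?m'}" using sub ne by blast
  qed
qed

text \<open>If the common point is the minimum of \<open>X\<close>, it lies in \<open>D\<close> and so comes after the minimum of \<open>D\<close>;
maximality makes the two minima equal.\<close>

lemma simple_subset_meets_top:
  assumes r: "linear_order_on E r" and D: "finite D" "D \<subseteq> E"
    and simple: "simple_subset r \<D>" "X \<in> \<D>" "D \<in> \<D>" "X \<noteq> D"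
    and top: "(min_elem r X, min_elem r D) \<in> r"
  shows "X \<inter> D \<subseteq> {min_elem r D}"
proof (rule ccontr)
  assume *: "\<not> X \<inter> D \<subseteq> {min_elem r D}"
  then have "X \<inter> D = {min_elem r X}" using simple unfolding simple_subset_def by blast
  moreover from this have "min_elem r X = min_elem r D"
    using min_elem_le[OF r D(1) _ D(2), of "min_elem r X"] top r
    by (auto simp: order_on_defs dest: antisymD)
  ultimately show False using * by auto
qed

text \<open>All neighbours of \<open>D\<close> contain its minimum, so two of them would form a triangle with \<open>D\<close>. The only
neighbour is then the only other member containing that minimum, which is why the minimum belongs to
the tree circuit of the remaining tree.\<close>

lemma tree_top_leaf:
  assumes r: "linear_order_on E r" and D: "finite D" "D \<subseteq> E"
    and simple: "simple_subset r T" and tree: "is_tree (intersection_graph T)"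
    and top: "D \<in> T" "\<And>X. X \<in> T \<Longrightarrow> (min_elem r X, min_elem r D) \<in> r" and "T \<noteq> {D}"
  shows "is_tree (intersection_graph (T - {D}))"
    and "D \<inter> \<Union>(T - {D}) = {min_elem r D}"
    and "min_elem r D \<in> tree_circuit (T - {D})"
proof -
  let ?x = "min_elem r D"
  have meet: "X \<inter> D \<subseteq> {?x}" if "X \<in> T" "X \<noteq> D" for X
    using simple_subset_meets_top[OF r D simple that(1) top(1) that(2)] top(2)[OF that(1)] .
  obtain D' where D': "D' \<in> T" "D' \<noteq> D" "D \<inter> D' \<noteq> {}"
    using is_tree_neighbour[OF tree top(1) \<open>T \<noteq> {D}\<close>] .
  have x: "?x \<in> D" "?x \<in> D'" using meet[OF D'(1,2)] D'(3) by auto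
  have unique: "X = D'" if "X \<in> T" "X \<noteq> D" "?x \<in> X" for X
    using is_tree_no_triple_intersection[OF tree top(1) that(1) D'(1) x(1) that(3) x(2)] that D' by blast
  then show "is_tree (intersection_graph (T - {D}))"
    using meet by (intro is_tree_remove_leaf[OF tree D'(1,2)]) blast
  show "D \<inter> \<Union>(T - {D}) = {?x}" using meet x D' by blast
  show "?x \<in> tree_circuit (T - {D})"
    unfolding mem_tree_circuit_iff using unique x D' by blast
qed

lemma ex_top_member:
  assumes r: "linear_order_on E r" and "finite \<D>" "\<D> \<noteq> {}"
    and \<D>: "\<And>D. D \<in> \<D> \<Longrightarrow> finite D \<and> D \<noteq> {} \<and> D \<subseteq> E"
  obtains D where "D \<in> \<D>" "\<And>X. X \<in> \<D> \<Longrightarrow> (min_elem r X, min_elem r D) \<in> r"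
proof -
  have "min_elem r ` \<D> \<subseteq> E" using min_elem_mem[OF r] \<D> by blast
  then show ?thesis
    using finite_linear_order_has_max[OF r, of "min_elem r ` \<D>"] assms(2,3) that by auto
qed

text \<open>The tree circuit contains the broken circuit of the top member \<open>D\<close>, but the minimum \<open>y\<close> of the tree
circuit, which is removed when breaking it, may lie in there. In that case the member \<open>D1\<close> found by
induction in the remaining tree does the job. Its broken circuit avoids \<open>y\<close>, being disjoint from that
of \<open>D\<close>. It also avoids \<open>x = min D\<close>, the only point that attaching \<open>D\<close> destroys: otherwise the
remaining tree circuit would have a minimum below \<open>x\<close>, which survives the attachment and precedes
\<open>y\<close>, whereas \<open>y \<in> D\<close> comes after \<open>x\<close>.\<close>

lemma tree_circuit_contains_broken_circuit:
  assumes r: "linear_order_on E r" and "finite E" and "finite T"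
    and "\<And>D. D \<in> T \<Longrightarrow> D \<noteq> {} \<and> D \<subseteq> E"
    and "simple_subset r T" and "is_tree (intersection_graph T)"
  shows "\<exists>D\<in>T. broken_circuit r D \<subseteq> broken_circuit r (tree_circuit T)"
  using assms(3-)
proof (induction "card T" arbitrary: T rule: less_induct)
  case less
  have fin: "finite X" if "X \<subseteq> E" for X using that \<open>finite E\<close> by (rule finite_subset)
  note T = less.prems(2)
  have "T \<noteq> {}" using less.prems(4) by (auto simp: is_tree_def graph_connected_def)
  then obtain D where D: "D \<in> T" and top: "\<And>X. X \<in> T \<Longrightarrow> (min_elem r X, min_elem r D) \<in> r"
    using ex_top_member[OF r less.prems(1)] T fin by metis
  show ?case
  proof (cases "T = {D}")
    case False
    let ?x = "min_elem r D" and ?S = "T - {D}" and ?y = "min_elem r (tree_circuit T)"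
    have D_E: "finite D" "D \<subseteq> E" using T[OF D] fin by auto
    note leaf = tree_top_leaf[OF r D_E less.prems(3,4) D top False]
    have T_eq: "T = insert D ?S" using D by blast
    have tc: "tree_circuit T = (tree_circuit ?S - {?x}) \<union> (D - {?x})"
      by (subst T_eq, rule tree_circuit_attach[OF _ leaf(2)]) simp
    have sub: "tree_circuit ?S \<subseteq> E" "tree_circuit T \<subseteq> E"
      using T tree_circuit_subset[of ?S] tree_circuit_subset[of T] by blast+
    show ?thesis
    proof (cases "?y \<in> broken_circuit r D")
      case False
      then have "broken_circuit r D \<subseteq> broken_circuit r (tree_circuit T)"
        unfolding broken_circuit_def[of r "tree_circuit T"] tc by (auto simp: broken_circuit_def)
      then show ?thesis using D by blast
    next
      case True
      have "card ?S < card T" using less.prems(1) D by (rule card_Diff1_less)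
      then obtain D1 where D1: "D1 \<in> ?S" "broken_circuit r D1 \<subseteq> broken_circuit r (tree_circuit ?S)"
        using less.hyps[of ?S] less.prems leaf(1) simple_subset_mono[of r T ?S] by auto
      have "?x \<notin> broken_circuit r D1"
      proof
        assume "?x \<in> broken_circuit r D1"
        then have ne: "min_elem r (tree_circuit ?S) \<noteq> ?x" using D1 by (auto simp: broken_circuit_def)
        let ?m = "min_elem r (tree_circuit ?S)"
        have S: "finite (tree_circuit ?S)" "tree_circuit ?S \<noteq> {}" using fin sub leaf(3) by auto
        have m: "?m \<in> tree_circuit ?S" "(?m, ?x) \<in> r"
          using min_elem_mem[OF r S sub(1)] min_elem_le[OF r S sub(1) leaf(3)] by auto
        then have "?m \<in> tree_circuit T" using tc ne by blast
        then have "(?y, ?m) \<in> r" using min_elem_le[OF r _ _ sub(2)] fin[OF sub(2)] by blast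
        moreover have "(?x, ?y) \<in> r"
          using True min_elem_le[OF r D_E(1) _ D_E(2)] by (auto simp: broken_circuit_def)
        ultimately show False using m(2) ne r by (auto simp: order_on_defs dest: transD antisymD)
      qed
      then have "broken_circuit r D1 \<subseteq> tree_circuit T"
        using D1 unfolding tc by (auto simp: broken_circuit_def)
      moreover have "broken_circuit r D \<inter> broken_circuit r D1 = {}"
        using less.prems(3) T fin D D1(1) simple_subset_iff_disjoint_broken_circuits[OF r, of T] by blast
      ultimately have "broken_circuit r D1 \<subseteq> broken_circuit r (tree_circuit T)"
        using True by (auto simp: broken_circuit_def[of r "tree_circuit T"])
      then show ?thesis using D1 by blast
    qed
  qed (use D in auto)
qed

section \<open>Circuits as tree circuits\<close>

text \<open>Stated for any antichain \<open>\<C>\<close> with weak elimination, so that the induction may pass to the members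
avoiding an element \<open>b\<close>. Let \<open>D\<close> be the top member, \<open>x\<close> its minimum and \<open>B = D - {x}\<close>. Elements of
\<open>B\<close> occur in no other member of \<open>\<D>\<close>, so for \<open>b \<in> B\<close> the pair of \<open>{C \<in> \<C>. b \<notin> C}\<close> and \<open>\<D> - {D}\<close>
again satisfies the hypotheses. It follows that a circuit which does not contain all of \<open>B\<close> is
disjoint from \<open>B\<close>.\<close>

lemma circuits_eq_tree_circuits:
  assumes r: "linear_order_on E r" and "finite E"
    and "\<And>C. C \<in> \<C> \<Longrightarrow> C \<subseteq> E \<and> broken_circuit r C \<noteq> {}"
    and "\<And>C C'. C \<in> \<C> \<Longrightarrow> C' \<in> \<C> \<Longrightarrow> C \<subseteq> C' \<Longrightarrow> C = C'"
    and "\<And>C C' e. C \<in> \<C> \<Longrightarrow> C' \<in> \<C> \<Longrightarrow> C \<noteq> C' \<Longrightarrow> e \<in> C \<inter> C' \<Longrightarrow>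
      \<exists>C''\<in>\<C>. C'' \<subseteq> C \<union> C' - {e}"
    and "\<D> \<subseteq> \<C>" and "simple_subset r \<D>"
    and "\<And>C. C \<in> \<C> \<Longrightarrow> \<exists>D\<in>\<D>. broken_circuit r D \<subseteq> broken_circuit r C"
  shows "\<C> = {tree_circuit T |T. T \<subseteq> \<D> \<and> is_tree (intersection_graph T)}"
  using assms(3-)
proof (induction "card \<D>" arbitrary: \<C> \<D> rule: less_induct)
  case less
  note \<C>_E = less.prems(1) and antichain = less.prems(2) and elim = less.prems(3)
    and \<D>_\<C> = less.prems(4) and simple = less.prems(5) and cover = less.prems(6)
  have "\<D> \<subseteq> Pow E" using \<C>_E \<D>_\<C> by blast
  then have fin_\<D>: "finite \<D>" using \<open>finite E\<close> finite_subset[of \<D> "Pow E"] by simp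
  have fin: "finite X" if "X \<subseteq> E" for X using that \<open>finite E\<close> by (rule finite_subset)
  show ?case
  proof (cases "\<D> = {}")
    case True
    then show ?thesis using cover by (auto simp: is_tree_def graph_connected_def)
  next
    case False
    have mem_\<D>: "finite D \<and> D \<noteq> {} \<and> D \<subseteq> E" if "D \<in> \<D>" for D
      using \<C>_E[of D] \<D>_\<C> that fin by (auto simp: broken_circuit_def)
    obtain D where D: "D \<in> \<D>" and top: "\<And>X. X \<in> \<D> \<Longrightarrow> (min_elem r X, min_elem r D) \<in> r"
      using ex_top_member[OF r fin_\<D> False] mem_\<D> by metis
    let ?x = "min_elem r D" and ?B = "broken_circuit r D" and ?\<D>' = "\<D> - {D}"
    have D_E: "finite D" "D \<subseteq> E" and D_\<C>: "D \<in> \<C>" using mem_\<D>[OF D] D \<D>_\<C> by auto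
    have x_D: "?x \<in> D" using min_elem_mem[OF r] mem_\<D>[OF D] by blast
    have B: "?B = D - {?x}" by (simp add: broken_circuit_def)
    have B_ne: "?B \<noteq> {}" using \<C>_E D_\<C> by blast
    have meet: "X \<inter> D \<subseteq> {?x}" if "X \<in> ?\<D>'" for X
      using simple_subset_meets_top[OF r D_E simple _ D _ top] that by blast

    have deletion: "{C \<in> \<C>. b \<notin> C} = {tree_circuit T |T. T \<subseteq> ?\<D>' \<and> is_tree (intersection_graph T)}"
      if b: "b \<in> ?B" for b
    proof (rule less.hyps)
      show "card ?\<D>' < card \<D>" using fin_\<D> D by (rule card_Diff1_less)
      show "?\<D>' \<subseteq> {C \<in> \<C>. b \<notin> C}" using \<D>_\<C> meet b B by blast
      show "simple_subset r ?\<D>'" using simple by (rule simple_subset_mono) blast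
      show "\<exists>D\<in>?\<D>'. broken_circuit r D \<subseteq> broken_circuit r C" if "C \<in> {C \<in> \<C>. b \<notin> C}" for C
      proof -
        obtain D' where "D' \<in> \<D>" "broken_circuit r D' \<subseteq> broken_circuit r C"
          using cover[of C] \<open>C \<in> {C \<in> \<C>. b \<notin> C}\<close> by blast
        moreover have "b \<notin> broken_circuit r C"
          using \<open>C \<in> {C \<in> \<C>. b \<notin> C}\<close> by (simp add: broken_circuit_def)
        ultimately show ?thesis using b by blast
      qed
      show "\<exists>C''\<in>{C \<in> \<C>. b \<notin> C}. C'' \<subseteq> C \<union> C' - {e}"
        if "C \<in> {C \<in> \<C>. b \<notin> C}" "C' \<in> {C \<in> \<C>. b \<notin> C}" "C \<noteq> C'" "e \<in> C \<inter> C'" for C C' e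
        using elim[of C C' e] that by blast
    qed (use \<C>_E antichain in auto)
    have deletion_iff: "C \<in> \<C> \<and> b \<notin> C \<longleftrightarrow>
        (\<exists>T. C = tree_circuit T \<and> T \<subseteq> ?\<D>' \<and> is_tree (intersection_graph T))"
      if "b \<in> ?B" for b C
      using eqset_imp_iff[OF deletion[OF that], of C] unfolding mem_Collect_eq .
    have avoids: "\<exists>T. C = tree_circuit T \<and> T \<subseteq> ?\<D>' \<and> is_tree (intersection_graph T)"
      if C: "C \<in> \<C>" "\<not> ?B \<subseteq> C" for C
    proof -
      obtain b where "b \<in> ?B" "b \<notin> C" using C(2) by blast
      then show ?thesis using deletion_iff[of b C] C(1) by simp
    qed
    have tree_\<C>: "tree_circuit T \<in> \<C>" if T: "T \<subseteq> ?\<D>'" "is_tree (intersection_graph T)" for T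
    proof -
      obtain b where "b \<in> ?B" using B_ne by blast
      then show ?thesis using deletion_iff[of b "tree_circuit T"] T by blast
    qed
    have tree_B: "tree_circuit T \<inter> ?B = {}" if "T \<subseteq> ?\<D>'" for T
      using that tree_circuit_subset[of T] meet unfolding B by blast
    have meet_T: "D \<inter> \<Union>T = {?x}" if "T \<subseteq> ?\<D>'" "?x \<in> tree_circuit T" for T
      using that tree_circuit_subset[of T] meet x_D by blast
    have attach: "tree_circuit (insert D T) = (tree_circuit T - {?x}) \<union> ?B"
      "is_tree (intersection_graph (insert D T))"
      if "T \<subseteq> ?\<D>'" "is_tree (intersection_graph T)" "?x \<in> tree_circuit T" for T
    proof -
      have "D \<notin> T" using that(1) by blast
      note m = meet_T[OF that(1,3)]
      show "tree_circuit (insert D T) = (tree_circuit T - {?x}) \<union> ?B"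
        using tree_circuit_attach[OF \<open>D \<notin> T\<close> m] B by simp
      show "is_tree (intersection_graph (insert D T))"
        by (rule is_tree_attach[OF that(2) \<open>D \<notin> T\<close> m that(3)])
    qed

    \<comment> \<open>Eliminating \<open>b \<in> B\<close> between \<open>C\<close> and \<open>D\<close> gives a circuit that misses \<open>b\<close>, hence misses all of \<open>B\<close>:
      up to passing to a smaller set, \<open>B\<close> has been replaced by \<open>x\<close> in \<open>C\<close>.\<close>
    have replace: "\<exists>T. T \<subseteq> ?\<D>' \<and> is_tree (intersection_graph T) \<and> ?x \<in> tree_circuit T \<and>
        tree_circuit T \<subseteq> insert ?x (C - ?B)"
      if C: "C \<in> \<C>" "?B \<subseteq> C" "C \<noteq> D" for C
    proof -
      obtain b where b: "b \<in> ?B" using B_ne by blast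
      have "?x \<notin> C" using antichain[OF D_\<C> C(1)] C B by blast
      obtain C' where C': "C' \<in> \<C>" "C' \<subseteq> C \<union> D - {b}"
        using elim[OF C(1) D_\<C> C(3), of b] b C(2) B by blast
      have "?x \<in> C'" using antichain[OF C'(1) C(1)] C' C(2) b B by blast
      obtain T where T: "T \<subseteq> ?\<D>'" "is_tree (intersection_graph T)" "C' = tree_circuit T"
        using avoids[OF C'(1)] C'(2) b by blast
      then show ?thesis using tree_B[OF T(1)] \<open>?x \<in> C'\<close> C'(2) B by (intro exI[of _ T]) blast
    qed
    \<comment> \<open>Conversely, eliminating \<open>x\<close> between a tree circuit and \<open>D\<close> gives a circuit \<open>C\<close>. It contains \<open>B\<close>,
      for otherwise it would lie properly inside the tree circuit; and replacing \<open>B\<close> by \<open>x\<close> in it leads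
      back inside the tree circuit, so nothing was lost.\<close>
    have attach_\<C>: "tree_circuit (insert D T) \<in> \<C>"
      if T: "T \<subseteq> ?\<D>'" "is_tree (intersection_graph T)" "?x \<in> tree_circuit T" for T
    proof -
      note T_\<C> = tree_\<C>[OF T(1,2)]
      have "tree_circuit T \<noteq> D" using tree_B[OF T(1)] B_ne B by blast
      then obtain C where C: "C \<in> \<C>" "C \<subseteq> tree_circuit T \<union> D - {?x}"
        using elim[OF T_\<C> D_\<C>, of ?x] T(3) x_D by blast
      have "?B \<subseteq> C"
      proof (rule ccontr)
        assume "\<not> ?B \<subseteq> C"
        then have "C \<inter> ?B = {}" using avoids[OF C(1)] tree_B by blast
        then have "C \<subseteq> tree_circuit T" using C(2) B by blast
        then show False using antichain[OF C(1) T_\<C>] C(2) T(3) by blast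
      qed
      moreover have "C \<noteq> D" using C(2) x_D by blast
      ultimately obtain S where S: "S \<subseteq> ?\<D>'" "is_tree (intersection_graph S)"
        "tree_circuit S \<subseteq> insert ?x (C - ?B)" using replace[OF C(1)] by blast
      have "tree_circuit S \<subseteq> tree_circuit T" using S(3) C(2) T(3) B by blast
      then have "tree_circuit S = tree_circuit T" using antichain tree_\<C>[OF S(1,2)] T_\<C> by blast
      then have "C = tree_circuit (insert D T)"
        unfolding attach(1)[OF T] using S(3) C(2) \<open>?B \<subseteq> C\<close> B by blast
      then show ?thesis using C(1) by simp
    qed

    show ?thesis
    proof (intro equalityI subsetI)
      fix C assume C: "C \<in> \<C>"
      consider "\<not> ?B \<subseteq> C" | "C = D" | "?B \<subseteq> C" "C \<noteq> D" by blast
      then show "C \<in> {tree_circuit T |T. T \<subseteq> \<D> \<and> is_tree (intersection_graph T)}"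
      proof cases
        case 1
        then show ?thesis using avoids[OF C] by blast
      next
        case 2
        then show ?thesis using D is_tree_singleton[of D] by (intro CollectI exI[of _ "{D}"]) simp
      next
        case 3
        then obtain T where T: "T \<subseteq> ?\<D>'" "is_tree (intersection_graph T)" "?x \<in> tree_circuit T"
          "tree_circuit T \<subseteq> insert ?x (C - ?B)" using replace[OF C] by blast
        have "tree_circuit (insert D T) \<subseteq> C"
          unfolding attach(1)[OF T(1-3)] using T(4) 3(1) by blast
        then have "C = tree_circuit (insert D T)"
          using antichain[OF attach_\<C>[OF T(1-3)] C] by simp
        then show ?thesis using attach(2)[OF T(1-3)] T(1) D by blast
      qed
    next
      fix C assume "C \<in> {tree_circuit T |T. T \<subseteq> \<D> \<and> is_tree (intersection_graph T)}"
      then obtain T where T: "T \<subseteq> \<D>" "is_tree (intersection_graph T)" "C = tree_circuit T" by blast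
      consider "D \<notin> T" | "T = {D}" | "D \<in> T" "T \<noteq> {D}" by blast
      then show "C \<in> \<C>"
      proof cases
        case 1
        then show ?thesis using tree_\<C>[of T] T by blast
      next
        case 2
        then show ?thesis using T D_\<C> by simp
      next
        case 3
        have "simple_subset r T" using simple T(1) by (rule simple_subset_mono)
        then have leaf: "is_tree (intersection_graph (T - {D}))" "?x \<in> tree_circuit (T - {D})"
          using tree_top_leaf[OF r D_E _ T(2) 3(1) _ 3(2)] top T(1) by blast+
        have "tree_circuit (insert D (T - {D})) \<in> \<C>"
          using attach_\<C>[OF _ leaf] T(1) by blast
        then show ?thesis using T(3) 3(1) by (simp add: insert_absorb)
      qed
    qed
  qed
qed

section \<open>Circuits of a matroid\<close>

lemma circuits_antichain:
  "C \<in> circuits E indep \<Longrightarrow> C' \<in> circuits E indep \<Longrightarrow> C \<subseteq> C' \<Longrightarrow> C = C'"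
  unfolding circuits_def by blast

lemma dependent_contains_circuit:
  assumes "finite E" and "X \<subseteq> E" and "\<not> indep X"
  obtains C where "C \<in> circuits E indep" "C \<subseteq> X"
proof -
  define F where "F = {Y. Y \<subseteq> X \<and> \<not> indep Y}"
  have "finite F" using assms(1,2) by (simp add: F_def finite_subset)
  moreover have "F \<noteq> {}" using assms(3) by (auto simp: F_def)
  ultimately obtain C where "C \<in> F" "\<forall>Y\<in>F. Y \<subseteq> C \<longrightarrow> C = Y"
    using finite_has_minimal[of F] by blast
  then have C: "C \<subseteq> X" "\<not> indep C" "\<And>Y. Y \<subset> C \<Longrightarrow> indep Y"
    unfolding F_def by blast+
  have "C \<in> circuits E indep" unfolding circuits_def using C assms(2) by blast
  then show ?thesis using C(1) that by blast
qed

text \<open>If \<open>C1 \<union> C2 - {e}\<close> were independent, a maximal independent subset \<open>I\<close> of \<open>C1 \<union> C2\<close> extending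
\<open>C2 - {f}\<close> with \<open>f \<in> C2 - C1\<close> could be augmented: it misses \<open>f\<close> and also some element of \<open>C1\<close>, so it is
smaller than \<open>C1 \<union> C2 - {e}\<close>.\<close>

lemma (in matroid) circuit_elimination:
  assumes C1: "C1 \<in> circuits E indep" and C2: "C2 \<in> circuits E indep" and "C1 \<noteq> C2"
    and e: "e \<in> C1 \<inter> C2"
  shows "\<exists>C\<in>circuits E indep. C \<subseteq> C1 \<union> C2 - {e}"
proof (rule ccontr)
  let ?U = "C1 \<union> C2"
  assume none: "\<not> ?thesis"
  have U: "?U \<subseteq> E" and dep: "\<not> indep C1" "\<not> indep C2" using C1 C2 by (auto simp: circuits_def)
  have fin: "finite ?U" using U finite_ground by (rule finite_subset)
  have ind: "indep (?U - {e})"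
    using dependent_contains_circuit[OF finite_ground, of "?U - {e}" indep] U none by blast
  obtain f where f: "f \<in> C2" "f \<notin> C1" using circuits_antichain[OF C2 C1] \<open>C1 \<noteq> C2\<close> by blast
  define F where "F = {I. indep I \<and> C2 - {f} \<subseteq> I \<and> I \<subseteq> ?U}"
  have "C2 - {f} \<in> F" using C2 f(1) unfolding circuits_def F_def by blast
  moreover have "finite F" using fin by (simp add: F_def finite_subset)
  ultimately obtain I where "I \<in> F" "\<forall>J\<in>F. I \<subseteq> J \<longrightarrow> I = J"
    using finite_has_maximal[of F] by blast
  then have I: "indep I" "C2 - {f} \<subseteq> I" "I \<subseteq> ?U"
    "\<And>y. y \<in> ?U \<Longrightarrow> indep (insert y I) \<Longrightarrow> y \<in> I"
    unfolding F_def by blast+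
  have "f \<notin> I" using I(1,2) dep(2) indep_subset[of I C2] by blast
  moreover obtain g where g: "g \<in> C1" "g \<notin> I" using I(1) dep(1) indep_subset[of I C1] by blast
  ultimately have "I \<subseteq> ?U - {f, g}" and "f \<noteq> g" using I(3) f by auto
  then have "card I \<le> card (?U - {f, g})" using fin by (intro card_mono) auto
  also have "\<dots> = card ?U - 2" using \<open>f \<noteq> g\<close> f(1) g(1) fin by (subst card_Diff_subset) auto
  also have "\<dots> < card ?U - 1"
    using \<open>f \<noteq> g\<close> f(1) g(1) fin card_mono[of ?U "{f, g}"] by auto
  also have "\<dots> = card (?U - {e})" using e fin by (subst card_Diff_singleton) auto
  finally obtain y where "y \<in> ?U - {e} - I" "indep (insert y I)"
    using augmentation[of I "?U - {e}"] I(1) ind by blast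
  then show False using I(4) by blast
qed


section \<open>Minimal broken circuits\<close>

lemma simple_matroid_circuits:
  assumes M: "simple_matroid E indep" and r: "linear_order_on E r" and C: "C \<in> circuits E indep"
  shows "C \<subseteq> E" "finite C" "C \<noteq> {}" "broken_circuit r C \<noteq> {}"
proof -
  show E: "C \<subseteq> E" using C by (simp add: circuits_def)
  have "matroid E indep" and card: "3 \<le> card C" using M C by (auto simp: simple_matroid_def)
  then show fin: "finite C" using finite_subset[OF E] by (simp add: matroid.finite_ground)
  show ne: "C \<noteq> {}" using card by auto
  have "card (broken_circuit r C) = card C - 1"
    unfolding broken_circuit_def using min_elem_mem[OF r fin ne E] fin by simp
  then show "broken_circuit r C \<noteq> {}" using card by auto
qed

lemma contains_minimal_broken_circuit:
  assumes "finite E" and "B \<in> broken_circuits E indep r"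
  obtains B' where "B' \<in> minimal_broken_circuits E indep r" "B' \<subseteq> B"
proof -
  have "broken_circuits E indep r \<subseteq> Pow E"
    by (auto simp: broken_circuits_def broken_circuit_def circuits_def)
  then have "finite (broken_circuits E indep r)" using assms(1) by (simp add: finite_subset)
  then show ?thesis
    using finite_has_minimal2[OF _ assms(2)] that unfolding minimal_broken_circuits_def by blast
qed

lemma broken_circuit_ideal_minimal_generators:
  assumes "finite E"
  shows "(broken_circuit_ideal E indep r :: (('a \<Rightarrow>\<^sub>0 nat) \<Rightarrow>\<^sub>0 'k::field) set) =
    Idl\<^bsub>mpoly_ring E\<^esub> (sqfree_monomial ` minimal_broken_circuits E indep r)"
proof -
  have bc: "B \<subseteq> E \<and> finite B" if "B \<in> broken_circuits E indep r" for B
    using that finite_subset[OF _ assms, of B]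
    by (auto simp: broken_circuits_def broken_circuit_def circuits_def)
  have mbc: "B \<subseteq> E \<and> finite B" if "B \<in> minimal_broken_circuits E indep r" for B
    using bc[of B] that by (simp add: minimal_broken_circuits_def)
  have "(\<exists>B\<in>broken_circuits E indep r. B \<subseteq> X) \<longleftrightarrow> (\<exists>B\<in>minimal_broken_circuits E indep r. B \<subseteq> X)" for X
    using contains_minimal_broken_circuit[OF assms, of _ indep r]
    by (metis (no_types, lifting) mem_Collect_eq minimal_broken_circuits_def subset_trans)
  then show ?thesis
    unfolding broken_circuit_ideal_generators[OF assms]
    by (intro Set.set_eqI) (simp add: mem_sqfree_ideal_iff[OF bc] mem_sqfree_ideal_iff[OF mbc])
qed

text \<open>Passing to the minimal broken circuits makes the monomial generators an antichain. Simplicity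
guarantees that no broken circuit is empty, so that the ideal is proper.\<close>

lemma complete_intersection_iff_disjoint:
  assumes M: "simple_matroid E indep" and r: "linear_order_on E r"
  shows "complete_intersection (mpoly_ring E :: (('a \<Rightarrow>\<^sub>0 nat) \<Rightarrow>\<^sub>0 'k::field) ring)
      (broken_circuit_ideal E indep r) \<longleftrightarrow> disjoint (minimal_broken_circuits E indep r)"
proof -
  let ?\<B> = "minimal_broken_circuits E indep r"
  have fin: "finite E" using M matroid.finite_ground by (auto simp: simple_matroid_def)
  have \<B>: "B \<subseteq> E \<and> finite B" "B \<noteq> {}" if B: "B \<in> ?\<B>" for B
  proof -
    obtain C where C: "C \<in> circuits E indep" "B = broken_circuit r C"
      using B by (auto simp: minimal_broken_circuits_def broken_circuits_def)
    show "B \<subseteq> E \<and> finite B" "B \<noteq> {}"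
      using simple_matroid_circuits[OF M r C(1)] C(2) by (auto simp: broken_circuit_def)
  qed
  have "?\<B> \<subseteq> Pow E" using \<B>(1) by blast
  then have "finite ?\<B>" using fin by (simp add: finite_subset)
  moreover have "{} \<notin> ?\<B>" using \<B>(2) by blast
  moreover have "\<not> B' \<subset> B" if "B \<in> ?\<B>" "B' \<in> ?\<B>" for B B'
    using that by (simp add: minimal_broken_circuits_def)
  ultimately show ?thesis
    unfolding broken_circuit_ideal_minimal_generators[OF fin]
    using complete_intersection_if_disjoint[of ?\<B> E] disjoint_if_complete_intersection[of ?\<B> E] \<B>(1)
    by blast
qed

text \<open>From left to right the simple subset consists of one circuit for each minimal broken circuit. From
right to left each minimal broken circuit contains, and hence is, the broken circuit of a member of the
simple subset.\<close>

lemma disjoint_iff_tree_circuits: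
  assumes M: "simple_matroid E indep" and r: "linear_order_on E r"
  shows "disjoint (minimal_broken_circuits E indep r) \<longleftrightarrow>
    (\<exists>\<D> \<subseteq> circuits E indep. simple_subset r \<D> \<and>
       circuits E indep = {tree_circuit \<D>' |\<D>'. \<D>' \<subseteq> \<D> \<and> is_tree (intersection_graph \<D>')})"
proof -
  let ?\<C> = "circuits E indep" and ?\<B> = "minimal_broken_circuits E indep r"
  interpret matroid E indep using M by (simp add: simple_matroid_def)
  note circuit = simple_matroid_circuits[OF M r]
  show ?thesis
  proof
    assume disj: "disjoint ?\<B>"
    define circuit_of where "circuit_of B = (SOME C. C \<in> ?\<C> \<and> broken_circuit r C = B)" for B
    have circuit_of: "circuit_of B \<in> ?\<C>" "broken_circuit r (circuit_of B) = B" if "B \<in> ?\<B>" for B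
      using that someI_ex[of "\<lambda>C. C \<in> ?\<C> \<and> broken_circuit r C = B"]
      by (auto simp: minimal_broken_circuits_def broken_circuits_def circuit_of_def)
    let ?\<D> = "circuit_of ` ?\<B>"
    have sub: "?\<D> \<subseteq> ?\<C>" using circuit_of by blast
    have mem: "finite D \<and> D \<noteq> {} \<and> D \<subseteq> E" if "D \<in> ?\<D>" for D
      using subsetD[OF sub that] circuit by blast
    have "broken_circuit r D \<inter> broken_circuit r D' = {}" if D: "D \<in> ?\<D>" "D' \<in> ?\<D>" "D \<noteq> D'" for D D'
    proof -
      obtain B B' where "B \<in> ?\<B>" "B' \<in> ?\<B>" "D = circuit_of B" "D' = circuit_of B'"
        using D by blast
      then show ?thesis using disjointD[OF disj, of B B'] circuit_of(2) D(3) by auto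
    qed
    then have simple: "simple_subset r ?\<D>"
      using simple_subset_iff_disjoint_broken_circuits[OF r mem] by auto
    have "?\<C> = {tree_circuit \<D>' |\<D>'. \<D>' \<subseteq> ?\<D> \<and> is_tree (intersection_graph \<D>')}"
    proof (rule circuits_eq_tree_circuits[OF r finite_ground _ _ _ sub simple])
      fix C assume "C \<in> ?\<C>"
      then obtain B where "B \<in> ?\<B>" "B \<subseteq> broken_circuit r C"
        using contains_minimal_broken_circuit[OF finite_ground, of "broken_circuit r C" indep r]
        by (auto simp: broken_circuits_def)
      then show "\<exists>D\<in>?\<D>. broken_circuit r D \<subseteq> broken_circuit r C" using circuit_of by auto
    qed (use circuit circuits_antichain[of _ E indep] circuit_elimination in auto)
    then show "\<exists>\<D> \<subseteq> ?\<C>. simple_subset r \<D> \<and>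
        ?\<C> = {tree_circuit \<D>' |\<D>'. \<D>' \<subseteq> \<D> \<and> is_tree (intersection_graph \<D>')}"
      using sub simple by blast
  next
    assume "\<exists>\<D> \<subseteq> ?\<C>. simple_subset r \<D> \<and>
      ?\<C> = {tree_circuit \<D>' |\<D>'. \<D>' \<subseteq> \<D> \<and> is_tree (intersection_graph \<D>')}"
    then obtain \<D> where \<D>: "\<D> \<subseteq> ?\<C>" "simple_subset r \<D>"
      "?\<C> = {tree_circuit T |T. T \<subseteq> \<D> \<and> is_tree (intersection_graph T)}" by blast
    have mem: "finite D \<and> D \<noteq> {} \<and> D \<subseteq> E" if "D \<in> \<D>" for D using that \<D>(1) circuit by blast
    have "?\<B> \<subseteq> broken_circuit r ` \<D>"
    proof
      fix B assume B: "B \<in> ?\<B>"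
      then obtain C where C: "C \<in> ?\<C>" "B = broken_circuit r C"
        by (auto simp: minimal_broken_circuits_def broken_circuits_def)
      then obtain T where T: "T \<subseteq> \<D>" "is_tree (intersection_graph T)" "C = tree_circuit T"
        using \<D>(3) by blast
      have "finite T" using finite_subset[of T "Pow E"] T(1) mem finite_ground by blast
      then obtain D where D: "D \<in> T" "broken_circuit r D \<subseteq> B"
        using tree_circuit_contains_broken_circuit[OF r finite_ground _ _ _ T(2)] T(1,3) C(2) mem
          simple_subset_mono[OF \<D>(2) T(1)] by blast
      have "broken_circuit r D \<in> broken_circuits E indep r"
        using D(1) T(1) \<D>(1) by (auto simp: broken_circuits_def)
      then have "B = broken_circuit r D" using B D(2) by (auto simp: minimal_broken_circuits_def)
      then show "B \<in> broken_circuit r ` \<D>" using D(1) T(1) by blast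
    qed
    moreover have "\<forall>D\<in>\<D>. \<forall>D'\<in>\<D>. D \<noteq> D' \<longrightarrow> broken_circuit r D \<inter> broken_circuit r D' = {}"
      using \<D>(2) simple_subset_iff_disjoint_broken_circuits[OF r mem] by blast
    then have "disjoint (broken_circuit r ` \<D>)"
      by (intro disjointI) (elim imageE, metis)
    ultimately show "disjoint ?\<B>" by (rule pairwise_subset[rotated])
  qed
qed

theorem theorem4p1:
  fixes n :: nat
    and indep :: "nat set \<Rightarrow> bool"
    and r :: "nat rel"
  assumes "simple_matroid {1..n} indep"
    and "linear_order_on {1..n} r"
  shows "(complete_intersection (mpoly_ring {1..n} :: ((nat \<Rightarrow>\<^sub>0 nat) \<Rightarrow>\<^sub>0 'k::field) ring)
            (broken_circuit_ideal {1..n} indep r) \<longleftrightarrow>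
          disjoint (minimal_broken_circuits {1..n} indep r)) \<and>
         (disjoint (minimal_broken_circuits {1..n} indep r) \<longleftrightarrow>
          (\<exists>\<D> \<subseteq> circuits {1..n} indep. simple_subset r \<D> \<and>
             circuits {1..n} indep =
               {tree_circuit \<D>' |\<D>'. \<D>' \<subseteq> \<D> \<and> is_tree (intersection_graph \<D>')}))"
  using complete_intersection_iff_disjoint[OF assms] disjoint_iff_tree_circuits[OF assms]
  by (rule conjI)

end
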